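(* Let $X$ be a compact Kähler manifold, let $(E,\Phi)$ be a Higgs bundle over $X$, let $h$ be a hermitian metric in $E$, and let $D_h=D_h'+D_h''$ be the Chern connection of $(E,h)$, with curvature $F_h$. Consider the $2k$-Hitchin equations for the pair $(h,\Phi)$: $$D_h\Phi=0,\qquad F_h^{1,1}+\tfrac14[\Phi,\bar\Phi_h]=0,\qquad [\Phi,\Phi]=0,\qquad F_h^{2,0}=0.$$ Then the last two equations, $[\Phi,\Phi]=0$ and $F_h^{2,0}=0$, are automatically satisfied, and, writing $\Phi=2\Phi'$ (so that $\Phi'$ is again a Higgs field on $E$), the full system of four equations holds if and only if $$D_h'\Phi'=0\qquad\text{and}\qquad F_h+[\Phi',\bar\Phi'_h]=0 .$$
   Context: $A^{p,q}_X(\mathrm{End}\,E)$ denotes the space of smooth $(p,q)$-forms on $X$ with values in $\mathrm{End}\,E$. A Higgs bundle over $X$ is a pair $(E,\Phi)$ where $E\to X$ is a holomorphic vector bundle and $\Phi\in A^{1,0}_X(\mathrm{End}\,E)$ (the Higgs field) is holomorphic and satisfies $\Phi\wedge\Phi=0$. A hermitian metric $h$ in $E$ is a smooth field of hermitian inner products on the fibres of $E$, linear in the first slot. The Chern connection $D_h=D_h'+D_h''$ (decomposition into $(1,0)$ and $(0,1)$ parts) is the unique connection on $E$ with $D_h''=d''$ (the holomorphic structure operator of $E$) and $dh(s,s')=h(D_hs,s')+h(s,D_hs')$ for all smooth sections $s,s'$. Its curvature is $F_h=D_h\wedge D_h$, and $F_h^{p,q}$ denotes its component of type $(p,q)$.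 For $\Psi\in A^{p,q}_X(\mathrm{End}\,E)$, $D_h\Psi$ and $D'_h\Psi$ denote the induced covariant exterior derivative and its part of type $(p+1,q)$. The hermitian conjugate $\bar\Psi_h\in A^{q,p}_X(\mathrm{End}\,E)$ of $\Psi\in A^{p,q}_X(\mathrm{End}\,E)$ is defined by $h(\bar\Psi_h s,s')=h(s,\Psi s')$ for all sections $s,s'$, where $h$ is extended to form-valued sections complex linearly in the first slot and conjugate linearly in the second; thus $\overline{(\psi\otimes\eta)}_h=\psi^{*_h}\otimes\bar\eta$ for an endomorphism $\psi$ and a scalar form $\eta$. For $\Phi\in A^{p,q}_X(\mathrm{End}\,E)$ and $\Psi\in A^{s,u}_X(\mathrm{End}\,E)$ the commutator is $[\Phi,\Psi]=\Phi\wedge\Psi-(-1)^{(p+q)(s+u)}\Psi\wedge\Phi$, where $\wedge$ combines the wedge product of forms with composition of endomorphisms. In particular, for a $(1,0)$-form $\Phi$, $[\Phi,\Phi]=2\,\Phi\wedge\Phi$ and $[\Phi,\bar\Phi_h]=\Phi\wedge\bar\Phi_h+\bar\Phi_h\wedge\Phi$. *)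

theory Defs
  imports "HOL-Analysis.Analysis"
begin

section \<open>Smooth and holomorphic functions on open sets\<close>

text \<open>All sets \<open>S\<close> below are meant to be open.\<close>

primrec Ck_on :: "nat \<Rightarrow> ('a::real_normed_vector \<Rightarrow> 'b::real_normed_vector) \<Rightarrow> 'a set \<Rightarrow> bool" where
  "Ck_on 0 f S \<longleftrightarrow> continuous_on S f"
| "Ck_on (Suc k) f S \<longleftrightarrow>
     (\<forall>x\<in>S. f differentiable (at x)) \<and> (\<forall>v. Ck_on k (\<lambda>x. frechet_derivative f (at x) v) S)"

definition smooth_on :: "('a::real_normed_vector \<Rightarrow> 'b::real_normed_vector) \<Rightarrow> 'a set \<Rightarrow> bool" where
  "smooth_on f S \<longleftrightarrow> (\<forall>k. Ck_on k f S)"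

text \<open>Holomorphic functions of several variables: differentiable with complex linear derivative.\<close>

definition hol_on :: "(complex^'n \<Rightarrow> complex) \<Rightarrow> (complex^'n) set \<Rightarrow> bool" where
  "hol_on f S \<longleftrightarrow>
     (\<forall>x\<in>S. \<exists>L. (f has_derivative L) (at x) \<and> (\<forall>c v. L (c *s v) = c * L v))"


section \<open>Complex manifolds\<close>

text \<open>The manifold is a whole Hausdorff type \<open>'x\<close>.  A chart is a pair of its (open) domain and the
  coordinate map; outside its domain the coordinate map is irrelevant.\<close>

type_synonym ('x, 'n) chart = "'x set \<times> ('x \<Rightarrow> complex^'n)"

definition chart_inv :: "('x, 'n) chart \<Rightarrow> complex^'n \<Rightarrow> 'x" where
  "chart_inv c = inv_into (fst c) (snd c)"

definition complex_atlas :: "('x::t2_space, 'n::finite) chart set \<Rightarrow> bool" where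
  "complex_atlas A \<longleftrightarrow>
     (\<Union>c\<in>A. fst c) = UNIV \<and>
     (\<forall>c\<in>A. open (fst c) \<and> open (snd c ` fst c) \<and> inj_on (snd c) (fst c) \<and>
        homeomorphism (fst c) (snd c ` fst c) (snd c) (chart_inv c)) \<and>
     (\<forall>c\<in>A. \<forall>d\<in>A. \<forall>i. hol_on (\<lambda>z. snd d (chart_inv c z) $ i) (snd c ` (fst c \<inter> fst d)))"

definition smooth_fun :: "('x::topological_space, 'n::finite) chart set \<Rightarrow> 'x set \<Rightarrow>
    ('x \<Rightarrow> 'b::real_normed_vector) \<Rightarrow> bool" where
  "smooth_fun A W f \<longleftrightarrow> (\<forall>c\<in>A. smooth_on (f \<circ> chart_inv c) (snd c ` (W \<inter> fst c)))"

definition hol_fun :: "('x::topological_space, 'n::finite) chart set \<Rightarrow> 'x set \<Rightarrow>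
    ('x \<Rightarrow> complex) \<Rightarrow> bool" where
  "hol_fun A W f \<longleftrightarrow> (\<forall>c\<in>A. hol_on (f \<circ> chart_inv c) (snd c ` (W \<inter> fst c)))"

text \<open>The real tangent space at \<open>x\<close>, with its complex structure \<open>J = i\<close>, is modelled by
  \<open>complex^'n\<close> by means of a preferred chart around \<open>x\<close>; another preferred chart gives a canonically
  isomorphic model.\<close>

definition chart_at :: "('x, 'n) chart set \<Rightarrow> 'x \<Rightarrow> ('x, 'n) chart" where
  "chart_at A x = (SOME c. c \<in> A \<and> x \<in> fst c)"

text \<open>\<open>coord_field A c v\<close> is the vector field on the domain of \<open>c\<close> which has the constant
  components \<open>v\<close> in the chart \<open>c\<close>.\<close>

definition coord_field :: "('x, 'n::finite) chart set \<Rightarrow> ('x, 'n) chart \<Rightarrow> complex^'n \<Rightarrow>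
    'x \<Rightarrow> complex^'n" where
  "coord_field A c v y = frechet_derivative (snd (chart_at A y) \<circ> chart_inv c) (at (snd c y)) v"

text \<open>The differential \<open>df\<close> at \<open>x\<close> of a function with values in a fixed vector space.\<close>

definition differential :: "('x, 'n::finite) chart set \<Rightarrow> ('x \<Rightarrow> 'b::real_normed_vector) \<Rightarrow>
    'x \<Rightarrow> complex^'n \<Rightarrow> 'b" where
  "differential A f x v =
     frechet_derivative (f \<circ> chart_inv (chart_at A x)) (at (snd (chart_at A x) x)) v"

text \<open>The exterior derivative is \<open>d\<omega>(u,v,w) = u \<omega>(v,w) + v \<omega>(w,u) + w \<omega>(u,v)\<close> for commuting vector
  fields, here for the fields which are constant in the preferred chart at \<open>x\<close>.  Compactness is not
  part of this definition.\<close>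

definition kaehler_form :: "('x::t2_space, 'n::finite) chart set \<Rightarrow>
    ('x \<Rightarrow> complex^'n \<Rightarrow> complex^'n \<Rightarrow> real) \<Rightarrow> bool" where
  "kaehler_form A \<omega> \<longleftrightarrow>
     (\<forall>x v. linear (\<omega> x v)) \<and>
     (\<forall>x u v. \<omega> x v u = - \<omega> x u v) \<and>
     (\<forall>c\<in>A. \<forall>u v. smooth_fun A (fst c) (\<lambda>y. \<omega> y (coord_field A c u y) (coord_field A c v y))) \<and>
     (\<forall>x u v. \<omega> x (\<i> *s u) (\<i> *s v) = \<omega> x u v) \<and>
     (\<forall>x u. u \<noteq> 0 \<longrightarrow> \<omega> x u (\<i> *s u) > 0) \<and>
     (\<forall>x u v w. let V = coord_field A (chart_at A x) in
        differential A (\<lambda>y. \<omega> y (V v y) (V w y)) x u +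
        differential A (\<lambda>y. \<omega> y (V w y) (V u y)) x v +
        differential A (\<lambda>y. \<omega> y (V u y) (V v y)) x w = 0)"


section \<open>Holomorphic vector bundles, sections and forms\<close>

text \<open>A bundle is a family of complex vector spaces \<open>E x\<close> with local trivialisations.  A basis of
  each \<open>E x\<close> is chosen, independently for all \<open>x\<close>, so that \<open>E x\<close> becomes \<open>complex^'r\<close>.  No regularity
  in \<open>x\<close> is attached to this choice: topology and holomorphic structure of the bundle come only from
  the trivialisations, which are pairs of an open set \<open>U\<close> and linear isomorphisms
  \<open>g x : E x \<rightarrow> complex^'r\<close> for \<open>x \<in> U\<close> (arbitrary in \<open>x\<close>) with holomorphic transition matrices.
  So the bundle need not be trivial.\<close>

type_synonym ('x, 'r) triv = "'x set \<times> ('x \<Rightarrow> complex^'r^'r)"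

definition holomorphic_bundle :: "('x::t2_space, 'n::finite) chart set \<Rightarrow>
    ('x, 'r::finite) triv set \<Rightarrow> bool" where
  "holomorphic_bundle A T \<longleftrightarrow>
     (\<Union>t\<in>T. fst t) = UNIV \<and>
     (\<forall>t\<in>T. open (fst t) \<and> (\<forall>x\<in>fst t. invertible (snd t x))) \<and>
     (\<forall>t\<in>T. \<forall>t'\<in>T. \<forall>i j.
        hol_fun A (fst t \<inter> fst t') (\<lambda>x. (snd t' x ** matrix_inv (snd t x)) $ i $ j))"

text \<open>Sections over \<open>W\<close>, \<open>E\<close>-valued and \<open>End E\<close>-valued forms are represented by functions on all of
  \<open>'x\<close> whose values outside \<open>W\<close> are irrelevant.  The values of forms are real multilinear on real
  tangent vectors.\<close>

definition smooth_section :: "('x::t2_space, 'n::finite) chart set \<Rightarrow> ('x, 'r::finite) triv set \<Rightarrow>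
    'x set \<Rightarrow> ('x \<Rightarrow> complex^'r) \<Rightarrow> bool" where
  "smooth_section A T W s \<longleftrightarrow> (\<forall>t\<in>T. smooth_fun A (W \<inter> fst t) (\<lambda>x. snd t x *v s x))"

definition smooth_form1 :: "('x::t2_space, 'n::finite) chart set \<Rightarrow> ('x, 'r::finite) triv set \<Rightarrow>
    'x set \<Rightarrow> ('x \<Rightarrow> complex^'n \<Rightarrow> complex^'r) \<Rightarrow> bool" where
  "smooth_form1 A T W \<beta> \<longleftrightarrow>
     (\<forall>x\<in>W. linear (\<beta> x)) \<and>
     (\<forall>c\<in>A. \<forall>v. smooth_section A T (W \<inter> fst c) (\<lambda>y. \<beta> y (coord_field A c v y)))"

definition smooth_End_form1 :: "('x::t2_space, 'n::finite) chart set \<Rightarrow> ('x, 'r::finite) triv set \<Rightarrow>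
    ('x \<Rightarrow> complex^'n \<Rightarrow> complex^'r^'r) \<Rightarrow> bool" where
  "smooth_End_form1 A T \<Psi> \<longleftrightarrow>
     (\<forall>x. linear (\<Psi> x)) \<and>
     (\<forall>c\<in>A. \<forall>t\<in>T. \<forall>v. smooth_fun A (fst c \<inter> fst t)
        (\<lambda>y. snd t y ** \<Psi> y (coord_field A c v y) ** matrix_inv (snd t y)))"

definition csmult :: "complex \<Rightarrow> complex^'r^'r \<Rightarrow> complex^'r^'r" where
  "csmult z M = (\<chi> i j. z * M $ i $ j)"

text \<open>\<open>\<Psi> \<in> A\<^sup>1\<^sup>,\<^sup>0(End E)\<close>\<close>

definition form10 :: "('x::t2_space, 'n::finite) chart set \<Rightarrow> ('x, 'r::finite) triv set \<Rightarrow>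
    ('x \<Rightarrow> complex^'n \<Rightarrow> complex^'r^'r) \<Rightarrow> bool" where
  "form10 A T \<Psi> \<longleftrightarrow>
     smooth_End_form1 A T \<Psi> \<and> (\<forall>x v. \<Psi> x (\<i> *s v) = csmult \<i> (\<Psi> x v))"

text \<open>The coefficients with respect to holomorphic coordinates and frames are holomorphic.\<close>

definition holomorphic_End_form1 :: "('x::t2_space, 'n::finite) chart set \<Rightarrow>
    ('x, 'r::finite) triv set \<Rightarrow> ('x \<Rightarrow> complex^'n \<Rightarrow> complex^'r^'r) \<Rightarrow> bool" where
  "holomorphic_End_form1 A T \<Psi> \<longleftrightarrow>
     (\<forall>c\<in>A. \<forall>t\<in>T. \<forall>v i j. hol_fun A (fst c \<inter> fst t)
        (\<lambda>y. (snd t y ** \<Psi> y (coord_field A c v y) ** matrix_inv (snd t y)) $ i $ j))"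

text \<open>Wedge product and commutator of two \<open>End E\<close>-valued 1-forms.  The sign in the commutator is
  \<open>-(-1)\<^sup>1\<^sup>\<cdot>\<^sup>1 = +1\<close>.\<close>

definition wedge :: "('x \<Rightarrow> 'v \<Rightarrow> complex^'r^'r) \<Rightarrow> ('x \<Rightarrow> 'v \<Rightarrow> complex^'r^'r) \<Rightarrow>
    'x \<Rightarrow> 'v \<Rightarrow> 'v \<Rightarrow> complex^'r^'r" where
  "wedge \<Phi> \<Psi> x u v = \<Phi> x u ** \<Psi> x v - \<Phi> x v ** \<Psi> x u"

definition commutator :: "('x \<Rightarrow> 'v \<Rightarrow> complex^'r^'r) \<Rightarrow> ('x \<Rightarrow> 'v \<Rightarrow> complex^'r^'r) \<Rightarrow>
    'x \<Rightarrow> 'v \<Rightarrow> 'v \<Rightarrow> complex^'r^'r" where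
  "commutator \<Phi> \<Psi> x u v = wedge \<Phi> \<Psi> x u v - (-1) ^ (1 * 1) *\<^sub>R wedge \<Psi> \<Phi> x u v"

definition higgs_field :: "('x::t2_space, 'n::finite) chart set \<Rightarrow> ('x, 'r::finite) triv set \<Rightarrow>
    ('x \<Rightarrow> complex^'n \<Rightarrow> complex^'r^'r) \<Rightarrow> bool" where
  "higgs_field A T \<Phi> \<longleftrightarrow>
     form10 A T \<Phi> \<and> holomorphic_End_form1 A T \<Phi> \<and> (\<forall>x u v. wedge \<Phi> \<Phi> x u v = 0)"


section \<open>Types of forms\<close>

text \<open>The complex linear and antilinear parts of real linear maps.  For a 2-form the parts are
  taken in each argument, which is evaluation of its complex bilinear extension on
  \<open>u = u\<^sup>1\<^sup>,\<^sup>0 + u\<^sup>0\<^sup>,\<^sup>1\<close> and \<open>v = v\<^sup>1\<^sup>,\<^sup>0 + v\<^sup>0\<^sup>,\<^sup>1\<close>.\<close>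

definition sec_part01 :: "(complex^'n \<Rightarrow> complex^'r) \<Rightarrow> complex^'n \<Rightarrow> complex^'r" where
  "sec_part01 \<beta> v = (1/2) *\<^sub>R (\<beta> v + \<i> *s \<beta> (\<i> *s v))"

definition part10 :: "(complex^'n \<Rightarrow> complex^'r^'r) \<Rightarrow> complex^'n \<Rightarrow> complex^'r^'r" where
  "part10 \<alpha> v = (1/2) *\<^sub>R (\<alpha> v - csmult \<i> (\<alpha> (\<i> *s v)))"

definition part01 :: "(complex^'n \<Rightarrow> complex^'r^'r) \<Rightarrow> complex^'n \<Rightarrow> complex^'r^'r" where
  "part01 \<alpha> v = (1/2) *\<^sub>R (\<alpha> v + csmult \<i> (\<alpha> (\<i> *s v)))"

definition part20 :: "('x \<Rightarrow> complex^'n \<Rightarrow> complex^'n \<Rightarrow> complex^'r^'r) \<Rightarrow>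
    'x \<Rightarrow> complex^'n \<Rightarrow> complex^'n \<Rightarrow> complex^'r^'r" where
  "part20 \<Omega> x u v = part10 (\<lambda>u'. part10 (\<lambda>v'. \<Omega> x u' v') v) u"

definition part11 :: "('x \<Rightarrow> complex^'n \<Rightarrow> complex^'n \<Rightarrow> complex^'r^'r) \<Rightarrow>
    'x \<Rightarrow> complex^'n \<Rightarrow> complex^'n \<Rightarrow> complex^'r^'r" where
  "part11 \<Omega> x u v =
     part10 (\<lambda>u'. part01 (\<lambda>v'. \<Omega> x u' v') v) u + part01 (\<lambda>u'. part10 (\<lambda>v'. \<Omega> x u' v') v) u"


section \<open>Hermitian metrics and the Chern connection\<close>

definition hermitian_metric :: "('x::t2_space, 'n::finite) chart set \<Rightarrow>
    ('x, 'r::finite) triv set \<Rightarrow> ('x \<Rightarrow> complex^'r \<Rightarrow> complex^'r \<Rightarrow> complex) \<Rightarrow> bool" where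
  "hermitian_metric A T h \<longleftrightarrow>
     (\<forall>x a b w. h x (a + b) w = h x a w + h x b w) \<and>
     (\<forall>x z a w. h x (z *s a) w = z * h x a w) \<and>
     (\<forall>x a b. h x b a = cnj (h x a b)) \<and>
     (\<forall>x a. a \<noteq> 0 \<longrightarrow> Re (h x a a) > 0) \<and>
     (\<forall>W s s'. open W \<longrightarrow> smooth_section A T W s \<longrightarrow> smooth_section A T W s' \<longrightarrow>
        smooth_fun A W (\<lambda>x. h x (s x) (s' x)))"

text \<open>For a real tangent vector \<open>v\<close> the defining equation of the conjugate \<open>\<Psi>\<^sup>-\<close> of a form reads
  \<open>h(\<Psi>\<^sup>-(v) a, b) = h(a, \<Psi>(v) b)\<close>, since \<open>h\<close> is conjugate linear on form-valued sections in the
  second slot.\<close>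

definition herm_conj :: "('x \<Rightarrow> complex^'r \<Rightarrow> complex^'r \<Rightarrow> complex) \<Rightarrow>
    ('x \<Rightarrow> 'v \<Rightarrow> complex^'r^'r) \<Rightarrow> 'x \<Rightarrow> 'v \<Rightarrow> complex^'r^'r" where
  "herm_conj h \<Psi> x v = (THE B. \<forall>a b. h x (B *v a) b = h x a (\<Psi> x v *v b))"

text \<open>A connection acts on smooth sections over arbitrary open sets, compatibly with restriction;
  its values at points near which the argument is not smooth are unspecified.\<close>

definition connection :: "('x::t2_space, 'n::finite) chart set \<Rightarrow> ('x, 'r::finite) triv set \<Rightarrow>
    (('x \<Rightarrow> complex^'r) \<Rightarrow> 'x \<Rightarrow> complex^'n \<Rightarrow> complex^'r) \<Rightarrow> bool" where
  "connection A T D \<longleftrightarrow>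
     (\<forall>W s. open W \<longrightarrow> smooth_section A T W s \<longrightarrow> smooth_form1 A T W (D s)) \<and>
     (\<forall>W s s'. open W \<longrightarrow> smooth_section A T W s \<longrightarrow> smooth_section A T W s' \<longrightarrow>
        (\<forall>x\<in>W. s x = s' x) \<longrightarrow> (\<forall>x\<in>W. D s x = D s' x)) \<and>
     (\<forall>W s s'. open W \<longrightarrow> smooth_section A T W s \<longrightarrow> smooth_section A T W s' \<longrightarrow>
        (\<forall>x\<in>W. \<forall>v. D (\<lambda>y. s y + s' y) x v = D s x v + D s' x v)) \<and>
     (\<forall>W f s. open W \<longrightarrow> smooth_fun A W f \<longrightarrow> smooth_section A T W s \<longrightarrow>
        (\<forall>x\<in>W. \<forall>v. D (\<lambda>y. f y *s s y) x v = differential A f x v *s s x + f x *s D s x v))"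

text \<open>The operator \<open>d''\<close> of the holomorphic structure, computed in the trivialisation \<open>t\<close>.\<close>

definition dbar :: "('x, 'n::finite) chart set \<Rightarrow> ('x, 'r::finite) triv \<Rightarrow>
    ('x \<Rightarrow> complex^'r) \<Rightarrow> 'x \<Rightarrow> complex^'n \<Rightarrow> complex^'r" where
  "dbar A t s x v =
     matrix_inv (snd t x) *v sec_part01 (differential A (\<lambda>y. snd t y *v s y) x) v"

definition chern_connection :: "('x::t2_space, 'n::finite) chart set \<Rightarrow>
    ('x, 'r::finite) triv set \<Rightarrow> ('x \<Rightarrow> complex^'r \<Rightarrow> complex^'r \<Rightarrow> complex) \<Rightarrow>
    (('x \<Rightarrow> complex^'r) \<Rightarrow> 'x \<Rightarrow> complex^'n \<Rightarrow> complex^'r) \<Rightarrow> bool" where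
  "chern_connection A T h D \<longleftrightarrow>
     connection A T D \<and>
     (\<forall>W s. open W \<longrightarrow> smooth_section A T W s \<longrightarrow>
        (\<forall>t\<in>T. \<forall>x\<in>W \<inter> fst t. \<forall>v. sec_part01 (D s x) v = dbar A t s x v)) \<and>
     (\<forall>W s s'. open W \<longrightarrow> smooth_section A T W s \<longrightarrow> smooth_section A T W s' \<longrightarrow>
        (\<forall>x\<in>W. \<forall>v. differential A (\<lambda>y. h y (s y) (s' y)) x v =
           h x (D s x v) (s' x) + h x (s x) (D s' x v)))"

text \<open>The covariant exterior derivative of an \<open>E\<close>-valued 1-form,
  \<open>(D\<beta>)(u,v) = D\<^sub>u(\<beta>(v)) - D\<^sub>v(\<beta>(u)) - \<beta>([u,v])\<close>, evaluated on coordinate fields of the preferred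
  chart at \<open>x\<close>, which commute.\<close>

definition ext_deriv1 :: "('x, 'n::finite) chart set \<Rightarrow>
    (('x \<Rightarrow> complex^'r) \<Rightarrow> 'x \<Rightarrow> complex^'n \<Rightarrow> complex^'r) \<Rightarrow>
    ('x \<Rightarrow> complex^'n \<Rightarrow> complex^'r) \<Rightarrow> 'x \<Rightarrow> complex^'n \<Rightarrow> complex^'n \<Rightarrow> complex^'r" where
  "ext_deriv1 A D \<beta> x u v =
     D (\<lambda>y. \<beta> y (coord_field A (chart_at A x) v y)) x u -
     D (\<lambda>y. \<beta> y (coord_field A (chart_at A x) u y)) x v"

text \<open>The curvature is the \<open>End E\<close>-valued 2-form \<open>F\<close> with \<open>F s = D(D s)\<close>.\<close>

definition curvature :: "('x::t2_space, 'n::finite) chart set \<Rightarrow> ('x, 'r::finite) triv set \<Rightarrow>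
    (('x \<Rightarrow> complex^'r) \<Rightarrow> 'x \<Rightarrow> complex^'n \<Rightarrow> complex^'r) \<Rightarrow>
    'x \<Rightarrow> complex^'n \<Rightarrow> complex^'n \<Rightarrow> complex^'r^'r" where
  "curvature A T D x u v = (THE M. \<forall>W s. open W \<longrightarrow> x \<in> W \<longrightarrow> smooth_section A T W s \<longrightarrow>
     M *v s x = ext_deriv1 A D (D s) x u v)"

text \<open>The induced covariant exterior derivative of an \<open>End E\<close>-valued 1-form \<open>\<Psi>\<close> is the
  \<open>End E\<close>-valued 2-form with \<open>(D\<Psi>) s = D(\<Psi> s) + \<Psi> \<and> D s\<close>.\<close>

definition cov_deriv_End :: "('x::t2_space, 'n::finite) chart set \<Rightarrow> ('x, 'r::finite) triv set \<Rightarrow>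
    (('x \<Rightarrow> complex^'r) \<Rightarrow> 'x \<Rightarrow> complex^'n \<Rightarrow> complex^'r) \<Rightarrow>
    ('x \<Rightarrow> complex^'n \<Rightarrow> complex^'r^'r) \<Rightarrow>
    'x \<Rightarrow> complex^'n \<Rightarrow> complex^'n \<Rightarrow> complex^'r^'r" where
  "cov_deriv_End A T D \<Psi> x u v = (THE M. \<forall>W s. open W \<longrightarrow> x \<in> W \<longrightarrow> smooth_section A T W s \<longrightarrow>
     M *v s x = ext_deriv1 A D (\<lambda>y w. \<Psi> y w *v s y) x u v +
       (\<Psi> x u *v D s x v - \<Psi> x v *v D s x u))"

text \<open>On forms of type \<open>(1,0)\<close>: \<open>D'\<Psi>\<close> is the part of \<open>D\<Psi>\<close> of type \<open>(2,0)\<close>.\<close>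

definition cov_deriv_End' :: "('x::t2_space, 'n::finite) chart set \<Rightarrow> ('x, 'r::finite) triv set \<Rightarrow>
    (('x \<Rightarrow> complex^'r) \<Rightarrow> 'x \<Rightarrow> complex^'n \<Rightarrow> complex^'r) \<Rightarrow>
    ('x \<Rightarrow> complex^'n \<Rightarrow> complex^'r^'r) \<Rightarrow>
    'x \<Rightarrow> complex^'n \<Rightarrow> complex^'n \<Rightarrow> complex^'r^'r" where
  "cov_deriv_End' A T D \<Psi> = part20 (cov_deriv_End A T D \<Psi>)"

definition hitchin_2k :: "('x::t2_space, 'n::finite) chart set \<Rightarrow> ('x, 'r::finite) triv set \<Rightarrow>
    ('x \<Rightarrow> complex^'r \<Rightarrow> complex^'r \<Rightarrow> complex) \<Rightarrow>
    (('x \<Rightarrow> complex^'r) \<Rightarrow> 'x \<Rightarrow> complex^'n \<Rightarrow> complex^'r) \<Rightarrow>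
    ('x \<Rightarrow> complex^'n \<Rightarrow> complex^'r^'r) \<Rightarrow> bool" where
  "hitchin_2k A T h D \<Phi> \<longleftrightarrow>
     (\<forall>x u v. cov_deriv_End A T D \<Phi> x u v = 0) \<and>
     (\<forall>x u v. part11 (curvature A T D) x u v + (1/4) *\<^sub>R commutator \<Phi> (herm_conj h \<Phi>) x u v = 0) \<and>
     (\<forall>x u v. commutator \<Phi> \<Phi> x u v = 0) \<and>
     (\<forall>x u v. part20 (curvature A T D) x u v = 0)"

end

theory Submission
  imports Defs "HOL-Complex_Analysis.Cauchy_Integral_Formula"
begin

text \<open>In the frame of a trivialisation the connection form is of type (1,0), because the constant
  sections of the frame are holomorphic; hence \<open>F\<^sup>0\<^sup>,\<^sup>2 = 0\<close>.  Metric compatibility makes \<open>F\<close>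
  skew-adjoint, and conjugation exchanges the types (2,0) and (0,2), so \<open>F\<^sup>2\<^sup>,\<^sup>0 = 0\<close> and
  \<open>F = F\<^sup>1\<^sup>,\<^sup>1\<close>.  Since \<open>\<Phi>\<close> is holomorphic, \<open>D\<Phi>\<close> is complex bilinear, i.e. equal to \<open>D'\<Phi>\<close>.  The
  factor 1/4 is absorbed by \<open>\<Phi> = 2\<Phi>'\<close>.

  Curvature and covariant derivative are given by \<open>THE\<close>, so both require a proof of tensoriality.
  This rests on the smoothness of holomorphic frames, i.e. on the smoothness of functions of several
  variables which are merely complex differentiable, and on the symmetry of second derivatives.\<close>

section \<open>Holomorphic functions are smooth\<close>


text \<open>Tangent vectors at \<open>y\<close> are written in the chart
  \<open>chart_at A y\<close>, which is picked by \<open>SOME\<close> and may jump with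
  \<open>y\<close>. A fixed \<open>v\<close> is therefore no smooth vector field, and everything is
  differentiated along \<open>coord_field A c v\<close> for one chart \<open>c\<close> kept fixed
  near the point in question. A connection controls only sections that are smooth in every
  trivialisation, so a frame can be used only once the transition matrices are known to be smooth.
  Their entries are given as complex differentiable at each point, with nothing said about
  continuity of the derivative. What has to be shown is that a directional derivative is complex
  differentiable again; on complex lines this comes within reach of the one-variable Cauchy
  inequalities. On a holomorphic frame section \<open>e\<close> the second derivative
  \<open>nabla c u (nabla c v e)\<close> is complex linear in \<open>v\<close>. Linearity in this
  one argument is already enough to kill the (0,2) part after antisymmetrisation.\<close>

lemma norm_complex_smult: "norm (c *s (w :: complex^'n)) = cmod c * norm w"
  by (simp add: norm_vec_def norm_mult L2_set_right_distrib)

lemma hol_on_has_derivative: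
  assumes "hol_on f S" "x \<in> S"
  shows "(f has_derivative frechet_derivative f (at x)) (at x)"
    and "frechet_derivative f (at x) (c *s v) = c * frechet_derivative f (at x) v"
proof -
  obtain L where L: "(f has_derivative L) (at x)" "\<forall>c v. L (c *s v) = c * L v"
    using assms unfolding hol_on_def by blast
  have "L = frechet_derivative f (at x)" by (rule frechet_derivative_at [OF L(1)])
  with L show "(f has_derivative frechet_derivative f (at x)) (at x)"
    "frechet_derivative f (at x) (c *s v) = c * frechet_derivative f (at x) v" by auto
qed

lemma hol_on_subset: "hol_on f S \<Longrightarrow> R \<subseteq> S \<Longrightarrow> hol_on f R"
  unfolding hol_on_def by blast

lemma hol_on_continuous: "hol_on f S \<Longrightarrow> continuous_on S f"
  by (meson continuous_at_imp_continuous_on has_derivative_continuous hol_on_has_derivative(1))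

section \<open>Restriction to complex lines and Cauchy estimates\<close>

lemma has_derivative_smult_const [derivative_intros]:
  "((\<lambda>\<zeta>. \<zeta> *s (w :: complex^'n)) has_derivative (\<lambda>\<zeta>. \<zeta> *s w)) F"
proof -
  have "bounded_linear (\<lambda>\<zeta>. \<zeta> *s (w :: complex^'n))"
    by (rule bounded_linear_intro [where K = "norm w"])
       (auto simp: vec_eq_iff algebra_simps norm_complex_smult)
  then show ?thesis by (rule bounded_linear_imp_has_derivative)
qed

text \<open>Complex linearity turns the derivative along a complex line into multiplication by a
  single number, that is, into a complex derivative in one variable.\<close>

lemma hol_on_line_deriv:
  assumes "hol_on F S" "y + \<zeta> *s w \<in> S"
  shows "((\<lambda>\<zeta>. F (y + \<zeta> *s w)) has_field_derivative frechet_derivative F (at (y + \<zeta> *s w)) w) (at \<zeta>)"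
proof -
  have 1: "((\<lambda>\<zeta>. y + \<zeta> *s w) has_derivative (\<lambda>\<zeta>. \<zeta> *s w)) (at \<zeta>)"
    by (auto intro!: derivative_eq_intros)
  have "((\<lambda>\<zeta>. F (y + \<zeta> *s w)) has_derivative
      (\<lambda>c. frechet_derivative F (at (y + \<zeta> *s w)) (c *s w))) (at \<zeta>)"
    using has_derivative_compose [OF 1 hol_on_has_derivative(1) [OF assms]] by simp
  then show ?thesis
    unfolding has_field_derivative_def hol_on_has_derivative(2) [OF assms]
    by (simp add: mult.commute [of _ "frechet_derivative F (at (y + \<zeta> *s w)) w"])
qed

lemma hol_on_line_holomorphic:
  assumes "hol_on F S" "\<And>\<zeta>. \<zeta> \<in> Z \<Longrightarrow> y + \<zeta> *s w \<in> S"
  shows "(\<lambda>\<zeta>. F (y + \<zeta> *s w)) holomorphic_on Z"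
  unfolding holomorphic_on_def field_differentiable_def
  using hol_on_line_deriv [OF assms(1)] assms(2) has_field_derivative_at_within by blast

text \<open>Cauchy's inequality on the slice \<open>\<zeta> \<mapsto> F (y + \<zeta> *s w)\<close>.
  The disc has half of the largest possible radius, so that its closure still maps into the open
  ball; this halving is the factor 2.\<close>

lemma hol_on_Cauchy_estimate:
  assumes hol: "hol_on F (ball y \<rho>)" and B: "\<And>x. x \<in> ball y \<rho> \<Longrightarrow> cmod (F x) \<le> B" and "\<rho> > 0"
  shows "cmod (frechet_derivative F (at y) w) \<le> 2 * B / \<rho> * norm w"
proof (cases "w = 0")
  case True
  have "frechet_derivative F (at y) (0 *s w) = 0"
    using \<open>\<rho> > 0\<close> by (subst hol_on_has_derivative(2) [OF hol]) auto
  with True show ?thesis by simp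
next
  case False
  define r where "r = \<rho> / (2 * norm w)"
  have r: "r > 0" using False \<open>\<rho> > 0\<close> by (simp add: r_def)
  have in_ball: "y + \<zeta> *s w \<in> ball y \<rho>" if "cmod \<zeta> \<le> r" for \<zeta>
  proof -
    have "cmod \<zeta> * norm w \<le> r * norm w" using that by (intro mult_right_mono) auto
    also have "\<dots> < \<rho>" using False \<open>\<rho> > 0\<close> by (simp add: r_def)
    finally show ?thesis by (simp add: dist_norm norm_complex_smult)
  qed
  let ?\<phi> = "\<lambda>\<zeta>. F (y + \<zeta> *s w)"
  have "cmod ((deriv ^^ 1) ?\<phi> 0) \<le> fact 1 * B / r ^ 1"
  proof (rule Cauchy_inequality)
    show "?\<phi> holomorphic_on ball 0 r"
      by (rule hol_on_line_holomorphic [OF hol], rule in_ball) simp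
    show "continuous_on (cball 0 r) ?\<phi>"
      by (rule holomorphic_on_imp_continuous_on, rule hol_on_line_holomorphic [OF hol], rule in_ball) simp
  qed (use r in \<open>auto intro!: B in_ball simp del: mem_ball\<close>)
  moreover have "deriv ?\<phi> 0 = frechet_derivative F (at y) w"
    using hol_on_line_deriv [OF hol, of y 0 w] \<open>\<rho> > 0\<close> by (intro DERIV_imp_deriv) auto
  ultimately show ?thesis using False by (simp add: r_def field_simps)
qed

text \<open>First order Taylor expansion of the slice from 0 to 1. Its second derivative on the unit
  disc is at most \<open>2 * B / r\<^sup>2\<close> by Cauchy's inequality on discs of radius
  \<open>r\<close>, and \<open>r = \<rho> / (2 * norm w)\<close> produces the 8.\<close>

lemma hol_on_Taylor_estimate:
  assumes hol: "hol_on F (ball y \<rho>)" and B: "\<And>x. x \<in> ball y \<rho> \<Longrightarrow> cmod (F x) \<le> B" and "\<rho> > 0"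
    and w: "norm w \<le> \<rho> / 4"
  shows "cmod (F (y + w) - F y - frechet_derivative F (at y) w) \<le> 8 * B / \<rho>\<^sup>2 * (norm w)\<^sup>2"
proof (cases "w = 0")
  case True
  have "frechet_derivative F (at y) (0 *s w) = 0"
    using \<open>\<rho> > 0\<close> by (subst hol_on_has_derivative(2) [OF hol]) auto
  with True show ?thesis by simp
next
  case False
  define r where "r = \<rho> / (2 * norm w)"
  \<comment> \<open>The slice maps the disc of radius \<open>2 * r\<close> into the ball. From
    \<open>r \<ge> 2\<close> follows \<open>1 + r < 2 * r\<close>, so discs of radius
    \<open>r\<close> centred in the unit disc stay inside it.\<close>
  have r: "r \<ge> 2" using False w by (simp add: r_def field_simps)
  have in_ball: "y + \<zeta> *s w \<in> ball y \<rho>" if "cmod \<zeta> < 2 * r" for \<zeta>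
  proof -
    have "cmod \<zeta> * norm w < 2 * r * norm w" using that False by (intro mult_strict_right_mono) auto
    also have "\<dots> = \<rho>" using False \<open>\<rho> > 0\<close> by (simp add: r_def)
    finally show ?thesis by (simp add: dist_norm norm_complex_smult)
  qed
  let ?\<phi> = "\<lambda>\<zeta>. F (y + \<zeta> *s w)"
  have hol\<phi>: "?\<phi> holomorphic_on ball 0 (2 * r)"
    by (rule hol_on_line_holomorphic [OF hol], rule in_ball) simp
  have near: "cmod \<zeta>' < 2 * r" if "cmod \<zeta> \<le> 1" "cmod (\<zeta> - \<zeta>') \<le> r" for \<zeta> \<zeta>'
  proof -
    have "cmod \<zeta>' \<le> cmod \<zeta> + cmod (\<zeta> - \<zeta>')"
      by (metis norm_minus_commute norm_triangle_sub)
    then show ?thesis using that r by linarith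
  qed
  have bound: "cmod ((deriv ^^ 2) ?\<phi> \<zeta>) \<le> fact 2 * B / r ^ 2" if "\<zeta> \<in> cball 0 1" for \<zeta>
  proof (rule Cauchy_inequality)
    show "?\<phi> holomorphic_on ball \<zeta> r"
      using that by (intro holomorphic_on_subset [OF hol\<phi>]) (auto intro!: near simp: dist_norm)
    show "continuous_on (cball \<zeta> r) ?\<phi>"
      using that by (intro holomorphic_on_imp_continuous_on holomorphic_on_subset [OF hol\<phi>])
        (auto intro!: near simp: dist_norm)
    show "cmod (?\<phi> \<zeta>') \<le> B" if "cmod (\<zeta> - \<zeta>') = r" for \<zeta>'
      using that \<open>\<zeta> \<in> cball 0 1\<close> by (intro B in_ball near [of \<zeta>]) auto
  qed (use r in auto)
  have "cmod ((deriv ^^ 0) ?\<phi> 1 - (\<Sum>i\<le>1. (deriv ^^ i) ?\<phi> 0 * (1 - 0) ^ i / fact i))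
      \<le> fact 2 * B / r ^ 2 * cmod (1 - 0) ^ Suc 1 / fact 1"
  proof (rule field_Taylor [where S = "cball 0 1"])
    fix i :: nat and \<zeta> :: complex assume "\<zeta> \<in> cball 0 1" "i \<le> 1"
    have "(deriv ^^ i) ?\<phi> holomorphic_on ball 0 (2 * r)"
      by (rule holomorphic_higher_deriv [OF hol\<phi>]) auto
    moreover have "\<zeta> \<in> ball 0 (2 * r)" using \<open>\<zeta> \<in> cball 0 1\<close> r by auto
    ultimately have "((deriv ^^ i) ?\<phi> has_field_derivative (deriv ^^ Suc i) ?\<phi> \<zeta>) (at \<zeta>)"
      using holomorphic_derivI [OF _ open_ball] by fastforce
    then show "((deriv ^^ i) ?\<phi> has_field_derivative (deriv ^^ Suc i) ?\<phi> \<zeta>) (at \<zeta> within cball 0 1)"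
      by (rule has_field_derivative_at_within)
  qed (use bound in \<open>auto simp: numeral_2_eq_2\<close>)
  moreover have "deriv ?\<phi> 0 = frechet_derivative F (at y) w"
    using hol_on_line_deriv [OF hol, of y 0 w] \<open>\<rho> > 0\<close> by (intro DERIV_imp_deriv) auto
  ultimately have "cmod (F (y + w) - F y - frechet_derivative F (at y) w) \<le> 2 * B / r\<^sup>2"
    by (simp add: diff_diff_eq)
  also have "\<dots> = 8 * B / \<rho>\<^sup>2 * (norm w)\<^sup>2"
    using False \<open>\<rho> > 0\<close> by (simp add: r_def field_simps power2_eq_square)
  finally show ?thesis .
qed

text \<open>The difference quotients \<open>h\<^sub>n\<close> of \<open>f\<close> in the direction \<open>v\<close> converge uniformly by the Taylor
  estimate, so by the Cauchy estimate their derivatives \<open>H\<^sub>n\<close> converge uniformly, too.\<close>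

lemma hol_on_frechet_derivative:
  assumes S: "open S" and hol: "hol_on f S"
  shows "hol_on (\<lambda>x. frechet_derivative f (at x) v) S"
  unfolding hol_on_def
proof
  fix x0 assume "x0 \<in> S"
  then obtain e where e: "e > 0" "cball x0 e \<subseteq> S" using S open_contains_cball by blast
  \<comment> \<open>Three concentric balls around \<open>x0\<close>: the limit is differentiated on
    radius \<open>R\<close>, the Cauchy estimate needs another \<open>R\<close> of room, and the
    Taylor estimate one more.\<close>
  define R where "R = e / 3"
  have R: "R > 0" using e by (simp add: R_def)
  have sub: "cball x0 (3 * R) \<subseteq> S" using e by (simp add: R_def)
  have "continuous_on (cball x0 (3 * R)) f"
    using hol_on_continuous [OF hol] continuous_on_subset sub by blast
  then obtain B where B: "\<And>x. x \<in> cball x0 (3 * R) \<Longrightarrow> cmod (f x) \<le> B"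
    using compact_continuous_image [OF _ compact_cball] compact_imp_bounded bounded_iff
    by (metis image_eqI)
  let ?f' = "\<lambda>x. frechet_derivative f (at x)"
  \<comment> \<open>Starting the step sizes at \<open>1 / N0\<close> makes every increment, not just
    almost every one, short enough for the Taylor estimate on balls of radius
    \<open>R\<close>.\<close>
  obtain N0 :: nat where N0: "N0 > 0" "norm v / real N0 \<le> R / 4"
  proof -
    obtain n :: nat where "real n > max 1 (4 * norm v / R)" using reals_Archimedean2 by blast
    then show ?thesis using R by (intro that [of n]) (auto simp: field_simps)
  qed
  define \<tau> where "\<tau> n = inverse (real (n + N0))" for n
  have \<tau>_pos: "\<tau> n > 0" for n using N0 by (simp add: \<tau>_def)
  have \<tau>_lim: "\<tau> \<longlonglongrightarrow> 0"
    unfolding \<tau>_def by (rule LIMSEQ_ignore_initial_segment [OF lim_inverse_n])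
  define w where "w n = complex_of_real (\<tau> n) *s v" for n
  have w_norm: "norm (w n) = \<tau> n * norm v" for n
    using \<tau>_pos [of n] by (simp add: w_def norm_complex_smult)
  have w_small: "norm (w n) \<le> R / 4" for n
  proof -
    have "\<tau> n * norm v \<le> inverse (real N0) * norm v"
      unfolding \<tau>_def using N0 by (intro mult_right_mono) (auto simp: field_simps)
    also have "inverse (real N0) * norm v = norm v / real N0" by (simp add: field_simps)
    finally show ?thesis using N0(2) unfolding w_norm by linarith
  qed
  define h where "h n x = (f (x + w n) - f x) / complex_of_real (\<tau> n)" for n x
  define H where "H n x u = (?f' (x + w n) u - ?f' x u) / complex_of_real (\<tau> n)" for n x u
  \<comment> \<open>The Taylor error for the increment \<open>w n\<close> is quadratic in
    \<open>\<tau> n\<close>; after division by \<open>\<tau> n\<close> the bound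
    \<open>K * \<tau> n\<close> remains.\<close>
  define K where "K = 8 * B / R\<^sup>2 * (norm v)\<^sup>2"
  have in_S: "x \<in> S" "x + w n \<in> S" if "x \<in> ball x0 (2 * R)" for x n
  proof -
    have "dist x0 (x + w n) \<le> dist x0 x + norm (w n)"
      by (metis add_diff_cancel_left' dist_commute dist_norm dist_triangle)
    then have "x + w n \<in> cball x0 (3 * R)" using that w_small [of n] R by auto
    then show "x + w n \<in> S" using sub by blast
    show "x \<in> S" using that R sub by auto
  qed
  have near: "cmod (h n x - ?f' x v) \<le> K * \<tau> n" if x: "x \<in> ball x0 (2 * R)" for n x
  proof -
    have ball: "ball x R \<subseteq> cball x0 (3 * R)"
    proof
      fix y assume "y \<in> ball x R"
      then show "y \<in> cball x0 (3 * R)" using x dist_triangle [of x0 y x] by auto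
    qed
    have "cmod (f (x + w n) - f x - ?f' x (w n)) \<le> 8 * B / R\<^sup>2 * (norm (w n))\<^sup>2"
      using ball sub R by (intro hol_on_Taylor_estimate hol_on_subset [OF hol] B w_small) auto
    also have "?f' x (w n) = complex_of_real (\<tau> n) * ?f' x v"
      unfolding w_def by (rule hol_on_has_derivative(2) [OF hol in_S(1) [OF x]])
    also have "f (x + w n) - f x - complex_of_real (\<tau> n) * ?f' x v
        = complex_of_real (\<tau> n) * (h n x - ?f' x v)"
      using \<tau>_pos [of n] by (simp add: h_def field_simps)
    finally have "\<tau> n * cmod (h n x - ?f' x v) \<le> \<tau> n * (K * \<tau> n)"
      using \<tau>_pos [of n]
      by (simp add: norm_mult w_norm K_def power_mult_distrib power2_eq_square mult_ac)
    then show ?thesis using \<tau>_pos [of n] by simp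
  qed
  have h_deriv: "(h n has_derivative H n x) (at x)" if x: "x \<in> ball x0 (2 * R)" for n x
  proof -
    have "((\<lambda>x. f (x + w n)) has_derivative (\<lambda>u. ?f' (x + w n) u)) (at x)"
      by (rule has_derivative_compose
          [OF has_derivative_add [OF has_derivative_ident has_derivative_const, simplified]
              hol_on_has_derivative(1) [OF hol in_S(2) [OF x]]])
    then show ?thesis
      unfolding h_def H_def divide_inverse
      by (intro derivative_intros hol_on_has_derivative(1) [OF hol in_S(1) [OF x]])
  qed
  have H_lin: "H n x (c *s u) = c * H n x u" if x: "x \<in> ball x0 (2 * R)" for n x c u
    by (simp add: H_def hol_on_has_derivative(2) [OF hol in_S(1) [OF x]]
        hol_on_has_derivative(2) [OF hol in_S(2) [OF x]] diff_divide_distrib algebra_simps)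
  \<comment> \<open>Both quotients are close to the same function \<open>?f' x v\<close>, so their
    difference is uniformly small on the ball of radius \<open>2 * R\<close>. Cauchy's estimate
    passes this on to the derivatives on radius \<open>R\<close>.\<close>
  have H_diff: "cmod (H n y u - H m y u) \<le> 2 * (K * (\<tau> n + \<tau> m)) / R * norm u"
    if y: "y \<in> ball x0 R" for n m y u
  proof -
    have ball: "ball y R \<subseteq> ball x0 (2 * R)"
    proof
      fix z assume "z \<in> ball y R"
      then show "z \<in> ball x0 (2 * R)" using y dist_triangle [of x0 z y] by auto
    qed
    let ?d = "\<lambda>x. h n x - h m x"
    have d: "(?d has_derivative (\<lambda>u. H n x u - H m x u)) (at x)" if "x \<in> ball x0 (2 * R)" for x
      using that by (intro derivative_intros h_deriv)
    have "hol_on ?d (ball y R)"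
      unfolding hol_on_def
    proof
      fix x assume "x \<in> ball y R"
      then have "x \<in> ball x0 (2 * R)" using ball by blast
      then show "\<exists>L. (?d has_derivative L) (at x) \<and> (\<forall>c v. L (c *s v) = c * L v)"
        using d H_lin by (intro exI [of _ "\<lambda>u. H n x u - H m x u"]) (auto simp: right_diff_distrib)
    qed
    moreover have "cmod (?d x) \<le> K * (\<tau> n + \<tau> m)" if "x \<in> ball y R" for x
    proof -
      have "cmod (?d x) \<le> cmod (h n x - ?f' x v) + cmod (h m x - ?f' x v)"
        using norm_triangle_ineq4 [of "h n x - ?f' x v" "h m x - ?f' x v"] by simp
      also have "\<dots> \<le> K * \<tau> n + K * \<tau> m" using that ball by (intro add_mono near) auto
      finally show ?thesis by (simp add: distrib_left)
    qed
    ultimately have "cmod (frechet_derivative ?d (at y) u) \<le> 2 * (K * (\<tau> n + \<tau> m)) / R * norm u"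
      by (rule hol_on_Cauchy_estimate [OF _ _ R])
    moreover have "frechet_derivative ?d (at y) = (\<lambda>u. H n y u - H m y u)"
      using y R by (intro frechet_derivative_at [OF d, symmetric]) auto
    ultimately show ?thesis by simp
  qed
  have "convergent (\<lambda>n. H n y u)" if y: "y \<in> ball x0 R" for y u
  proof -
    have "Cauchy (\<lambda>n. H n y u)"
    proof (rule metric_CauchyI)
      fix \<epsilon> :: real assume "\<epsilon> > 0"
      have "(\<lambda>n. 2 * K / R * norm u * \<tau> n) \<longlonglongrightarrow> 2 * K / R * norm u * 0"
        by (intro tendsto_intros \<tau>_lim)
      then have "\<forall>\<^sub>F n in sequentially. 2 * K / R * norm u * \<tau> n < \<epsilon> / 2"
        using \<open>\<epsilon> > 0\<close> by (intro order_tendstoD) auto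
      then obtain M where M: "\<And>n. n \<ge> M \<Longrightarrow> 2 * K / R * norm u * \<tau> n < \<epsilon> / 2"
        by (auto simp: eventually_sequentially)
      have "dist (H m y u) (H n y u) < \<epsilon>" if "m \<ge> M" "n \<ge> M" for m n
      proof -
        have "2 * (K * (\<tau> m + \<tau> n)) / R * norm u
            = 2 * K / R * norm u * \<tau> m + 2 * K / R * norm u * \<tau> n"
          by (simp add: algebra_simps add_divide_distrib)
        then show ?thesis using M [OF that(1)] M [OF that(2)] H_diff [OF y, of m u n]
          by (simp add: dist_norm)
      qed
      then show "\<exists>M. \<forall>m\<ge>M. \<forall>n\<ge>M. dist (H m y u) (H n y u) < \<epsilon>" by blast
    qed
    then show ?thesis by (simp add: Cauchy_convergent_iff)
  qed
  then have H_lim: "(\<lambda>n. H n y u) \<longlonglongrightarrow> lim (\<lambda>n. H n y u)" if "y \<in> ball x0 R" for y u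
    using that by (simp add: convergent_LIMSEQ_iff)
  define G where "G y u = lim (\<lambda>n. H n y u)" for y u
  \<comment> \<open>Let \<open>m\<close> tend to infinity in \<open>H_diff\<close>.\<close>
  have H_G: "cmod (H n y u - G y u) \<le> 2 * K / R * \<tau> n * norm u" if y: "y \<in> ball x0 R" for n y u
  proof (rule LIMSEQ_le)
    show "(\<lambda>m. cmod (H n y u - H m y u)) \<longlonglongrightarrow> cmod (H n y u - G y u)"
      unfolding G_def by (intro tendsto_intros H_lim y)
    have "(\<lambda>m. 2 * (K * (\<tau> n + \<tau> m)) / R * norm u) \<longlonglongrightarrow> 2 * (K * (\<tau> n + 0)) / R * norm u"
      using R by (intro tendsto_intros \<tau>_lim) auto
    then show "(\<lambda>m. 2 * (K * (\<tau> n + \<tau> m)) / R * norm u) \<longlonglongrightarrow> 2 * K / R * \<tau> n * norm u"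
      by (simp add: mult_ac)
  qed (use H_diff [OF y] in auto)
  have h_lim: "(\<lambda>n. h n x) \<longlonglongrightarrow> ?f' x v" if "x \<in> ball x0 (2 * R)" for x
  proof (rule LIM_zero_cancel, rule Lim_null_comparison)
    show "\<forall>\<^sub>F n in sequentially. norm (h n x - ?f' x v) \<le> K * \<tau> n"
      using near [OF that] by (intro always_eventually) auto
    have "(\<lambda>n. K * \<tau> n) \<longlonglongrightarrow> K * 0" by (intro tendsto_intros \<tau>_lim)
    then show "(\<lambda>n. K * \<tau> n) \<longlonglongrightarrow> 0" by simp
  qed
  \<comment> \<open>Termwise differentiation of the sequence \<open>h n\<close>. The limit function
    \<open>g\<close> is identified with \<open>?f' x v\<close> afterwards by uniqueness of
    limits.\<close>
  have "\<exists>g. \<forall>x\<in>ball x0 R. (\<lambda>n. h n x) \<longlonglongrightarrow> g x \<and> (g has_derivative G x) (at x within ball x0 R)"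
  proof (rule has_derivative_sequence)
    show "(h n has_derivative H n x) (at x within ball x0 R)" if "x \<in> ball x0 R" for n x
      using that R by (auto intro: has_derivative_at_withinI [OF h_deriv])
    show "\<forall>\<^sub>F n in sequentially. \<forall>x\<in>ball x0 R. \<forall>u. cmod (H n x u - G x u) \<le> \<epsilon> * norm u"
      if "\<epsilon> > 0" for \<epsilon>
    proof -
      have "(\<lambda>n. 2 * K / R * \<tau> n) \<longlonglongrightarrow> 2 * K / R * 0" by (intro tendsto_intros \<tau>_lim)
      then have "\<forall>\<^sub>F n in sequentially. 2 * K / R * \<tau> n < \<epsilon>"
        using \<open>\<epsilon> > 0\<close> by (intro order_tendstoD) auto
      then show ?thesis
      proof eventually_elim
        case (elim n)
        show ?case
        proof (intro ballI allI)
          fix x u assume "x \<in> ball x0 R"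
          then have "cmod (H n x u - G x u) \<le> 2 * K / R * \<tau> n * norm u" by (rule H_G)
          also have "\<dots> \<le> \<epsilon> * norm u" using elim by (intro mult_right_mono) auto
          finally show "cmod (H n x u - G x u) \<le> \<epsilon> * norm u" .
        qed
      qed
    qed
    show "(\<lambda>n. h n x0) \<longlonglongrightarrow> ?f' x0 v" using R by (intro h_lim) auto
  qed (use R in auto)
  then obtain g where g: "\<And>x. x \<in> ball x0 R \<Longrightarrow> (\<lambda>n. h n x) \<longlonglongrightarrow> g x"
      "\<And>x. x \<in> ball x0 R \<Longrightarrow> (g has_derivative G x) (at x within ball x0 R)" by blast
  have x0: "x0 \<in> ball x0 R" using R by simp
  have "(g has_derivative G x0) (at x0)"
    using g(2) [OF x0] at_within_open [OF x0 open_ball] by simp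
  then have "((\<lambda>x. ?f' x v) has_derivative G x0) (at x0)"
  proof (rule has_derivative_transform_within_open [OF _ open_ball x0])
    fix x assume "x \<in> ball x0 R"
    then show "g x = ?f' x v" using R by (intro LIMSEQ_unique [OF g(1) h_lim]) auto
  qed
  moreover have "G x0 (c *s u) = c * G x0 u" for c u
  proof (rule LIMSEQ_unique)
    show "(\<lambda>n. H n x0 (c *s u)) \<longlonglongrightarrow> G x0 (c *s u)" unfolding G_def by (rule H_lim [OF x0])
    have "(\<lambda>n. c * H n x0 u) \<longlonglongrightarrow> c * G x0 u"
      unfolding G_def by (intro tendsto_intros H_lim [OF x0])
    then show "(\<lambda>n. H n x0 (c *s u)) \<longlonglongrightarrow> c * G x0 u" using H_lin x0 R by simp
  qed
  ultimately show "\<exists>L. ((\<lambda>x. ?f' x v) has_derivative L) (at x0) \<and> (\<forall>c v. L (c *s v) = c * L v)"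
    by blast
qed

text \<open>Holomorphic functions are closed under directional derivatives, so the induction on the
  order runs over all of them at once.\<close>

lemma hol_on_imp_smooth_on:
  assumes "open S" "hol_on f S"
  shows "smooth_on f S"
  unfolding smooth_on_def
proof
  fix k show "Ck_on k f S"
    using assms(2)
  proof (induction k arbitrary: f)
    case 0
    then show ?case by (simp add: hol_on_continuous)
  next
    case (Suc k)
    then show ?case
      using hol_on_has_derivative(1) hol_on_frechet_derivative [OF assms(1)] differentiableI
      by fastforce
  qed
qed

section \<open>Symmetry of second derivatives\<close>

text \<open>Mean value inequality in \<open>\<tau>\<close> for the \<open>u\<close>-increment of
  \<open>f\<close> at \<open>z + \<tau> *\<^sub>R v\<close>, corrected by
  \<open>(\<tau> * s) *\<^sub>R P u\<close>. Its derivative is the \<open>u\<close>-increment of the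
  \<open>v\<close>-derivative minus \<open>s *\<^sub>R P u\<close>, and differentiability of the
  \<open>v\<close>-derivative at the point \<open>z\<close> makes this small compared with
  \<open>s\<close>.\<close>

lemma second_difference_estimate:
  fixes f :: "'a::real_normed_vector \<Rightarrow> 'b::real_normed_vector"
  assumes S: "open S" "z \<in> S" and f: "\<And>x. x \<in> S \<Longrightarrow> f differentiable (at x)"
    and P: "((\<lambda>x. frechet_derivative f (at x) v) has_derivative P) (at z)" and "e > 0"
  shows "\<exists>d>0. \<forall>s. 0 < s \<longrightarrow> s < d \<longrightarrow>
    norm (f (z + s *\<^sub>R u + s *\<^sub>R v) - f (z + s *\<^sub>R u) - f (z + s *\<^sub>R v) + f z - s\<^sup>2 *\<^sub>R P u) \<le> e * s\<^sup>2"
proof -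
  \<comment> \<open>All sample points lie within \<open>s * M\<close> of \<open>z\<close>; the
    summand 1 keeps \<open>M\<close> positive. Two errors \<open>e' * (s * M)\<close> over an
    interval of length \<open>s\<close> add up to \<open>e * s\<^sup>2\<close>, whence
    \<open>e' = e / (2 * M)\<close>.\<close>
  define M where "M = norm u + norm v + 1"
  have M: "M > 0" by (simp add: M_def add_nonneg_pos)
  define e' where "e' = e / (2 * M)"
  have e': "e' > 0" using \<open>e > 0\<close> M by (simp add: e'_def)
  obtain d1 where d1: "d1 > 0" "ball z d1 \<subseteq> S" using S open_contains_ball by blast
  let ?g = "\<lambda>x. frechet_derivative f (at x) v"
  obtain d2 where d2: "d2 > 0"
    "\<And>x. norm (x - z) < d2 \<Longrightarrow> norm (?g x - ?g z - P (x - z)) \<le> e' * norm (x - z)"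
    using P e' unfolding has_derivative_at_alt by blast
  have linP: "linear P" using P has_derivative_linear by blast
  show ?thesis
  proof (intro exI [of _ "min d1 d2 / M"] conjI allI impI)
    show "min d1 d2 / M > 0" using d1 d2 M by simp
    fix s :: real assume s: "0 < s" "s < min d1 d2 / M"
    then have sM: "s * M < d1" "s * M < d2" using M by (auto simp: field_simps)
    have small: "norm (a *\<^sub>R u + \<tau> *\<^sub>R v) \<le> s * M" if "0 \<le> a" "a \<le> s" "0 \<le> \<tau>" "\<tau> \<le> s" for a \<tau>
    proof -
      have "norm (a *\<^sub>R u + \<tau> *\<^sub>R v) \<le> a * norm u + \<tau> * norm v"
        using norm_triangle_ineq [of "a *\<^sub>R u" "\<tau> *\<^sub>R v"] that by simp
      also have "\<dots> \<le> s * norm u + s * norm v" using that by (intro add_mono mult_right_mono) auto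
      also have "\<dots> \<le> s * M" using s by (simp add: M_def algebra_simps)
      finally show ?thesis .
    qed
    define \<psi> where
      "\<psi> \<tau> = f (z + s *\<^sub>R u + \<tau> *\<^sub>R v) - f (z + \<tau> *\<^sub>R v) - (\<tau> * s) *\<^sub>R P u" for \<tau>
    define \<psi>' where "\<psi>' \<tau> = ?g (z + s *\<^sub>R u + \<tau> *\<^sub>R v) - ?g (z + \<tau> *\<^sub>R v) - s *\<^sub>R P u" for \<tau>
    have inS: "z + a *\<^sub>R u + \<tau> *\<^sub>R v \<in> S" if "0 \<le> a" "a \<le> s" "0 \<le> \<tau>" "\<tau> \<le> s" for a \<tau>
    proof -
      have "z + a *\<^sub>R u + \<tau> *\<^sub>R v \<in> ball z d1"
        using small [OF that] sM(1) unfolding mem_ball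
        by (metis add.assoc add_diff_cancel_left' dist_commute dist_norm le_less_trans)
      then show ?thesis using d1(2) by blast
    qed
    have deriv: "((\<lambda>\<tau>. f (z + a *\<^sub>R u + \<tau> *\<^sub>R v)) has_derivative (\<lambda>h. h *\<^sub>R ?g (z + a *\<^sub>R u + \<tau> *\<^sub>R v)))
        (at \<tau>)" if "0 \<le> a" "a \<le> s" "0 \<le> \<tau>" "\<tau> \<le> s" for a \<tau>
    proof -
      have D: "(f has_derivative frechet_derivative f (at (z + a *\<^sub>R u + \<tau> *\<^sub>R v)))
          (at (z + a *\<^sub>R u + \<tau> *\<^sub>R v))"
        using f [OF inS [OF that]] frechet_derivative_works by blast
      have "((\<lambda>\<tau>. z + a *\<^sub>R u + \<tau> *\<^sub>R v) has_derivative (\<lambda>h. h *\<^sub>R v)) (at \<tau>)"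
        by (auto intro!: derivative_eq_intros)
      from has_derivative_compose [OF this D] show ?thesis
        by (simp add: linear_cmul [OF has_derivative_linear [OF D]])
    qed
    have "norm (\<psi> s - \<psi> 0) \<le> (2 * e' * s * M) * norm (s - 0)"
    proof (rule differentiable_bound [where S = "{0..s}"])
      fix \<tau> assume \<tau>: "\<tau> \<in> {0..s}"
      have "(\<psi> has_derivative (\<lambda>h. h *\<^sub>R \<psi>' \<tau>)) (at \<tau>)"
      proof -
        have "((\<lambda>\<tau>. (\<tau> * s) *\<^sub>R P u) has_derivative (\<lambda>h. (h * s) *\<^sub>R P u)) (at \<tau>)"
          by (auto intro!: derivative_intros)
        moreover have "((\<lambda>\<tau>. f (z + \<tau> *\<^sub>R v)) has_derivative (\<lambda>h. h *\<^sub>R ?g (z + \<tau> *\<^sub>R v))) (at \<tau>)"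
          using deriv [of 0 \<tau>] \<tau> s by simp
        moreover have "(\<psi> has_derivative (\<lambda>h. h *\<^sub>R ?g (z + s *\<^sub>R u + \<tau> *\<^sub>R v)
            - h *\<^sub>R ?g (z + \<tau> *\<^sub>R v) - (h * s) *\<^sub>R P u)) (at \<tau>)"
          unfolding \<psi>_def using deriv [of s \<tau>] \<tau> s calculation
          by (intro has_derivative_diff) auto
        ultimately show ?thesis by (simp add: \<psi>'_def scaleR_diff_right)
      qed
      then show "(\<psi> has_derivative (\<lambda>h. h *\<^sub>R \<psi>' \<tau>)) (at \<tau> within {0..s})"
        by (rule has_derivative_at_withinI)
      have est: "norm (?g (z + a *\<^sub>R u + \<tau> *\<^sub>R v) - ?g z - P (a *\<^sub>R u + \<tau> *\<^sub>R v)) \<le> e' * (s * M)"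
        if "0 \<le> a" "a \<le> s" for a
      proof -
        have "norm (a *\<^sub>R u + \<tau> *\<^sub>R v) \<le> s * M" using small that \<tau> by auto
        moreover have "norm (?g (z + a *\<^sub>R u + \<tau> *\<^sub>R v) - ?g z - P (a *\<^sub>R u + \<tau> *\<^sub>R v))
            \<le> e' * norm (a *\<^sub>R u + \<tau> *\<^sub>R v)"
          using d2(2) [of "z + (a *\<^sub>R u + \<tau> *\<^sub>R v)"] sM(2) calculation by (simp add: add.assoc)
        ultimately show ?thesis using e' by (meson less_imp_le mult_left_mono order_trans)
      qed
      \<comment> \<open>The linear parts at the two points differ by exactly
        \<open>s *\<^sub>R P u\<close>, so that only two remainder terms are left.\<close>
      have "\<psi>' \<tau> = (?g (z + s *\<^sub>R u + \<tau> *\<^sub>R v) - ?g z - P (s *\<^sub>R u + \<tau> *\<^sub>R v))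
          - (?g (z + 0 *\<^sub>R u + \<tau> *\<^sub>R v) - ?g z - P (0 *\<^sub>R u + \<tau> *\<^sub>R v))"
        by (simp add: \<psi>'_def linear_add [OF linP] linear_cmul [OF linP])
      also have "norm \<dots> \<le> e' * (s * M) + e' * (s * M)"
        using s by (intro order_trans [OF norm_triangle_ineq4] add_mono est) auto
      finally have "norm (\<psi>' \<tau>) \<le> 2 * e' * s * M" by (simp add: mult_ac)
      then show "onorm (\<lambda>h. h *\<^sub>R \<psi>' \<tau>) \<le> 2 * e' * s * M"
        by (intro onorm_le) (simp add: mult.commute mult_left_mono)
    qed (use s in auto)
    moreover have "\<psi> s - \<psi> 0 =
        f (z + s *\<^sub>R u + s *\<^sub>R v) - f (z + s *\<^sub>R u) - f (z + s *\<^sub>R v) + f z - s\<^sup>2 *\<^sub>R P u"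
      by (simp add: \<psi>_def power2_eq_square algebra_simps)
    moreover have "(2 * e' * s * M) * norm (s - 0) = e * s\<^sup>2"
      using M s by (simp add: e'_def power2_eq_square field_simps)
    ultimately show "norm (f (z + s *\<^sub>R u + s *\<^sub>R v) - f (z + s *\<^sub>R u) - f (z + s *\<^sub>R v) + f z - s\<^sup>2 *\<^sub>R P u)
        \<le> e * s\<^sup>2" by simp
  qed
qed

text \<open>The second difference is symmetric in \<open>u\<close> and \<open>v\<close>. After
  division by \<open>s\<^sup>2\<close> it approximates either mixed derivative with error
  \<open>e / 2\<close>, so the two are within every positive \<open>e\<close> of each other.\<close>

lemma frechet_derivative_symmetric:
  fixes f :: "'a::real_normed_vector \<Rightarrow> 'b::real_normed_vector"
  assumes S: "open S" "z \<in> S" and f: "\<And>x. x \<in> S \<Longrightarrow> f differentiable (at x)"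
    and f': "\<And>w. (\<lambda>x. frechet_derivative f (at x) w) differentiable (at z)"
  shows "frechet_derivative (\<lambda>x. frechet_derivative f (at x) v) (at z) u =
    frechet_derivative (\<lambda>x. frechet_derivative f (at x) u) (at z) v"
proof -
  let ?P = "\<lambda>v. frechet_derivative (\<lambda>x. frechet_derivative f (at x) v) (at z)"
  have P: "((\<lambda>x. frechet_derivative f (at x) v) has_derivative ?P v) (at z)" for v
    using f' frechet_derivative_works by blast
  have "norm (?P v u - ?P u v) \<le> e" if "e > 0" for e :: real
  proof -
    obtain d1 where d1: "d1 > 0" "\<And>s. 0 < s \<Longrightarrow> s < d1 \<Longrightarrow>
        norm (f (z + s *\<^sub>R u + s *\<^sub>R v) - f (z + s *\<^sub>R u) - f (z + s *\<^sub>R v) + f z - s\<^sup>2 *\<^sub>R ?P v u)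
        \<le> e / 2 * s\<^sup>2"
      using second_difference_estimate [OF S f P, of "e / 2" u] \<open>e > 0\<close> by auto
    obtain d2 where d2: "d2 > 0" "\<And>s. 0 < s \<Longrightarrow> s < d2 \<Longrightarrow>
        norm (f (z + s *\<^sub>R v + s *\<^sub>R u) - f (z + s *\<^sub>R v) - f (z + s *\<^sub>R u) + f z - s\<^sup>2 *\<^sub>R ?P u v)
        \<le> e / 2 * s\<^sup>2"
      using second_difference_estimate [OF S f P, of "e / 2" v] \<open>e > 0\<close> by auto
    define s where "s = min d1 d2 / 2"
    have s: "0 < s" "s < d1" "s < d2" using d1(1) d2(1) by (auto simp: s_def)
    let ?\<Delta> = "f (z + s *\<^sub>R u + s *\<^sub>R v) - f (z + s *\<^sub>R u) - f (z + s *\<^sub>R v) + f z"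
    have \<Delta>: "f (z + s *\<^sub>R v + s *\<^sub>R u) - f (z + s *\<^sub>R v) - f (z + s *\<^sub>R u) + f z = ?\<Delta>"
      by (simp add: add_ac)
    have "s\<^sup>2 * norm (?P v u - ?P u v) = norm (s\<^sup>2 *\<^sub>R (?P v u - ?P u v))" by simp
    also have "s\<^sup>2 *\<^sub>R (?P v u - ?P u v) = ((?\<Delta> - s\<^sup>2 *\<^sub>R ?P u v) - (?\<Delta> - s\<^sup>2 *\<^sub>R ?P v u))"
      by (simp add: scaleR_diff_right)
    also have "norm \<dots> \<le> e / 2 * s\<^sup>2 + e / 2 * s\<^sup>2"
      by (rule order_trans [OF norm_triangle_ineq4 add_mono
            [OF d2(2) [OF s(1,3), unfolded \<Delta>] d1(2) [OF s(1,2)]]])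
    finally have "s\<^sup>2 * norm (?P v u - ?P u v) \<le> s\<^sup>2 * e" by (simp add: field_simps)
    then show ?thesis using s(1) by simp
  qed
  then have "norm (?P v u - ?P u v) \<le> 0" by (rule dense_ge)
  then show ?thesis by simp
qed

section \<open>Calculus of smooth functions\<close>

lemma Ck_on_subset:
  assumes "Ck_on k f S" "R \<subseteq> S"
  shows "Ck_on k f R"
  using assms(1)
proof (induction k arbitrary: f)
  case 0
  then show ?case using continuous_on_subset [OF _ assms(2)] by simp
next
  case (Suc k)
  have "Ck_on k (\<lambda>x. frechet_derivative f (at x) v) R" for v
    using Suc.prems by (intro Suc.IH) simp
  then show ?case using Suc.prems assms(2) by auto
qed

lemma Ck_on_SucD: "Ck_on (Suc k) f S \<Longrightarrow> Ck_on k f S"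
proof (induction k arbitrary: f)
  case 0
  have "continuous (at x) f" if "x \<in> S" for x
    using 0 that by (intro differentiable_imp_continuous_within) simp
  then show ?case by (simp add: continuous_at_imp_continuous_on)
next
  case (Suc k)
  have "Ck_on k (\<lambda>x. frechet_derivative f (at x) v) S" for v
    using Suc.prems by (intro Suc.IH) (rule Ck_on.simps(2) [THEN iffD1, THEN conjunct2, rule_format])
  then show ?case using Suc.prems by simp
qed

lemma Ck_on_Suc_has_derivative:
  "Ck_on (Suc k) f S \<Longrightarrow> x \<in> S \<Longrightarrow> (f has_derivative frechet_derivative f (at x)) (at x)"
  using frechet_derivative_works [of f "at x"] by simp

text \<open>Openness matters here: the derivatives in \<open>Ck_on\<close> are taken
  \<open>at x\<close>, so they depend on the values in a full neighbourhood of
  \<open>x\<close>.\<close>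

lemma Ck_on_cong:
  assumes "open S" "\<And>x. x \<in> S \<Longrightarrow> f x = g x" "Ck_on k f S"
  shows "Ck_on k g S"
  using assms(2,3)
proof (induction k arbitrary: f g)
  case 0
  then show ?case using continuous_on_eq by auto
next
  case (Suc k)
  have D: "(g has_derivative frechet_derivative f (at x)) (at x)" if "x \<in> S" for x
    using has_derivative_transform_within_open
      [OF Ck_on_Suc_has_derivative [OF Suc.prems(2) that] \<open>open S\<close> that] Suc.prems(1) by blast
  then have eq: "frechet_derivative f (at x) = frechet_derivative g (at x)" if "x \<in> S" for x
    using that frechet_derivative_at by blast
  have "Ck_on k (\<lambda>x. frechet_derivative g (at x) v) S" for v
  proof (rule Suc.IH)
    show "Ck_on k (\<lambda>x. frechet_derivative f (at x) v) S" using Suc.prems(2) by simp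
  qed (simp add: eq)
  moreover have "\<forall>x\<in>S. g differentiable (at x)"
    using D unfolding differentiable_def by blast
  ultimately show ?case by simp
qed

lemma Ck_on_const: "Ck_on k (\<lambda>x. c) S"
  by (induction k arbitrary: c) auto

lemma Ck_on_add:
  assumes "open S" "Ck_on k f S" "Ck_on k g S"
  shows "Ck_on k (\<lambda>x. f x + g x) S"
  using assms(2,3)
proof (induction k arbitrary: f g)
  case 0
  then show ?case by (auto intro: continuous_on_add)
next
  case (Suc k)
  have D: "((\<lambda>x. f x + g x) has_derivative
      (\<lambda>v. frechet_derivative f (at x) v + frechet_derivative g (at x) v)) (at x)" if "x \<in> S" for x
    by (intro has_derivative_add Ck_on_Suc_has_derivative [where k = k, OF _ that] Suc.prems)
  have "Ck_on k (\<lambda>x. frechet_derivative (\<lambda>x. f x + g x) (at x) v) S" for v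
    by (rule Ck_on_cong [OF \<open>open S\<close>, of "\<lambda>x. frechet_derivative f (at x) v + frechet_derivative g (at x) v"])
       (use Suc frechet_derivative_at [OF D, symmetric] in auto)
  moreover have "\<forall>x\<in>S. (\<lambda>x. f x + g x) differentiable (at x)"
    using D unfolding differentiable_def by blast
  ultimately show ?case by simp
qed

text \<open>A single induction with the product rule, later used for scalar multiples and
  matrix-vector products. Each summand of the derivative pairs a function with a derivative, so
  \<open>Ck_on_SucD\<close> lowers the undifferentiated factor to order \<open>k\<close>.\<close>

lemma Ck_on_bounded_bilinear:
  assumes "open S" and B: "bounded_bilinear B" and "Ck_on k f S" "Ck_on k g S"
  shows "Ck_on k (\<lambda>x. B (f x) (g x)) S"
  using assms(3,4)
proof (induction k arbitrary: f g)
  case 0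
  then show ?case by (auto intro: bounded_bilinear.continuous_on [OF B])
next
  case (Suc k)
  let ?f' = "\<lambda>x. frechet_derivative f (at x)" and ?g' = "\<lambda>x. frechet_derivative g (at x)"
  have D: "((\<lambda>x. B (f x) (g x)) has_derivative (\<lambda>v. B (f x) (?g' x v) + B (?f' x v) (g x))) (at x)"
    if "x \<in> S" for x
    by (intro bounded_bilinear.FDERIV [OF B] Ck_on_Suc_has_derivative [where k = k, OF _ that] Suc.prems)
  have "Ck_on k (\<lambda>x. frechet_derivative (\<lambda>x. B (f x) (g x)) (at x) v) S" for v
  proof (rule Ck_on_cong [OF \<open>open S\<close>])
    have "Ck_on k f S" "Ck_on k g S" using Suc.prems by (blast intro: Ck_on_SucD)+
    moreover have "Ck_on k (\<lambda>x. ?f' x v) S" "Ck_on k (\<lambda>x. ?g' x v) S" using Suc.prems by simp_all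
    ultimately show "Ck_on k (\<lambda>x. B (f x) (?g' x v) + B (?f' x v) (g x)) S"
      by (intro Ck_on_add [OF \<open>open S\<close>] Suc.IH)
    show "B (f x) (?g' x v) + B (?f' x v) (g x) = frechet_derivative (\<lambda>x. B (f x) (g x)) (at x) v"
      if "x \<in> S" for x
      by (subst frechet_derivative_at [OF D [OF that], symmetric]) (rule refl)
  qed
  moreover have "\<forall>x\<in>S. (\<lambda>x. B (f x) (g x)) differentiable (at x)"
    using D unfolding differentiable_def by blast
  ultimately show ?case by simp
qed

lemma Ck_on_bounded_linear:
  assumes "open S" and L: "bounded_linear L" and "Ck_on k f S"
  shows "Ck_on k (\<lambda>x. L (f x)) S"
proof -
  \<comment> \<open>A linear map is a bilinear one whose other factor is the constant 1.\<close>
  have "bounded_bilinear (\<lambda>(r::real) x. r *\<^sub>R L x)"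
    using bounded_bilinear.comp [OF bounded_bilinear_scaleR bounded_linear_ident L] by simp
  from Ck_on_bounded_bilinear [OF \<open>open S\<close> this Ck_on_const [of k 1] assms(3)] show ?thesis by simp
qed

section \<open>Complex manifolds\<close>

lemma bounded_bilinear_complex_smult:
  "bounded_bilinear (\<lambda>(z::complex) (w::complex^'m). z *s w)"
  unfolding bilinear_conv_bounded_bilinear [symmetric] bilinear_def
  by (intro conjI allI linearI) (auto simp: vec_eq_iff algebra_simps)

lemma bounded_bilinear_matrix_vector:
  "bounded_bilinear (\<lambda>(M::complex^'m^'k) w. M *v w)"
  unfolding bilinear_conv_bounded_bilinear [symmetric] bilinear_def
  by (intro conjI allI linearI)
     (auto simp: vec_eq_iff matrix_vector_mult_def algebra_simps sum.distrib scaleR_sum_right)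

lemma bounded_linear_axis: "bounded_linear (\<lambda>z. axis i z :: 'b::euclidean_space^'m)"
  unfolding linear_conv_bounded_linear [symmetric]
  by (rule linearI) (auto simp: vec_eq_iff axis_def)

lemma vec_eq_sum_axis: "(x :: 'b::euclidean_space^'m) = (\<Sum>i\<in>UNIV. axis i (x $ i))"
  by (simp add: vec_eq_iff axis_def if_distrib cong: if_cong)

lemma has_derivative_vec_componentwise:
  fixes f :: "'a::real_normed_vector \<Rightarrow> 'b::euclidean_space^'m"
  assumes "\<And>i. ((\<lambda>x. f x $ i) has_derivative (\<lambda>v. f' v $ i)) F"
  shows "(f has_derivative f') F"
proof -
  have "((\<lambda>x. \<Sum>i\<in>UNIV. axis i (f x $ i)) has_derivative (\<lambda>v. \<Sum>i\<in>UNIV. axis i (f' v $ i))) F"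
    by (intro has_derivative_sum bounded_linear.has_derivative [OF bounded_linear_axis] assms)
  then show ?thesis by (simp flip: vec_eq_sum_axis)
qed

text \<open>On the domain of \<open>c\<close> this is the partial derivative in the coordinates of
  \<open>c\<close>, see \<open>coord_deriv_eq\<close>, even though \<open>differential\<close> uses
  another chart at each point.\<close>

definition coord_deriv :: "('x, 'n::finite) chart set \<Rightarrow> ('x, 'n) chart \<Rightarrow> complex^'n \<Rightarrow>
    ('x \<Rightarrow> 'b::real_normed_vector) \<Rightarrow> 'x \<Rightarrow> 'b" where
  "coord_deriv A c v f y = differential A f y (coord_field A c v y)"

locale complex_manifold =
  fixes A :: "('x::t2_space, 'n::finite) chart set"
  assumes atlas: "complex_atlas A"
begin

lemma chart_at_in: "chart_at A x \<in> A" and in_chart_at: "x \<in> fst (chart_at A x)"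
proof -
  have "\<exists>c. c \<in> A \<and> x \<in> fst c" using atlas unfolding complex_atlas_def by blast
  from someI_ex [OF this] show "chart_at A x \<in> A" "x \<in> fst (chart_at A x)"
    by (auto simp: chart_at_def)
qed

lemma open_chart: "c \<in> A \<Longrightarrow> open (fst c)"
  using atlas unfolding complex_atlas_def by blast

lemma chart_inv_chart: "c \<in> A \<Longrightarrow> y \<in> fst c \<Longrightarrow> chart_inv c (snd c y) = y"
  using atlas unfolding complex_atlas_def chart_inv_def by (auto simp: inv_into_f_f)

lemma open_chart_image:
  assumes "c \<in> A" "open W"
  shows "open (snd c ` (W \<inter> fst c))"
proof -
  have "continuous_on (snd c ` fst c) (chart_inv c)" "open (snd c ` fst c)"
    using atlas assms(1) unfolding complex_atlas_def homeomorphism_def by auto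
  then have "open (snd c ` fst c \<inter> chart_inv c -` W)"
    using assms(2) by (rule continuous_open_preimage)
  moreover have "snd c ` (W \<inter> fst c) = snd c ` fst c \<inter> chart_inv c -` W"
    using chart_inv_chart [OF assms(1)] by auto
  ultimately show ?thesis by simp
qed

section \<open>Smooth functions on the manifold\<close>

lemma smooth_fun_subset: "smooth_fun A W f \<Longrightarrow> V \<subseteq> W \<Longrightarrow> smooth_fun A V f"
  unfolding smooth_fun_def smooth_on_def by (meson Ck_on_subset Int_mono image_mono order_refl)

lemma smooth_fun_cong:
  assumes "open W" "\<And>y. y \<in> W \<Longrightarrow> f y = g y" "smooth_fun A W f"
  shows "smooth_fun A W g"
  unfolding smooth_fun_def smooth_on_def
proof (intro ballI allI)
  fix c k assume c: "c \<in> A"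
  show "Ck_on k (g \<circ> chart_inv c) (snd c ` (W \<inter> fst c))"
  proof (rule Ck_on_cong [OF open_chart_image [OF c \<open>open W\<close>]])
    show "Ck_on k (f \<circ> chart_inv c) (snd c ` (W \<inter> fst c))"
      using assms(3) c unfolding smooth_fun_def smooth_on_def by blast
  qed (use assms(2) chart_inv_chart [OF c] in auto)
qed

lemma smooth_fun_const: "smooth_fun A W (\<lambda>y. k)"
  unfolding smooth_fun_def smooth_on_def comp_def by (simp add: Ck_on_const)

lemma smooth_fun_bounded_linear:
  assumes "open W" "bounded_linear L" "smooth_fun A W f"
  shows "smooth_fun A W (\<lambda>y. L (f y))"
  using assms Ck_on_bounded_linear [OF open_chart_image]
  unfolding smooth_fun_def smooth_on_def comp_def by blast

lemma smooth_fun_bounded_bilinear: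
  assumes "open W" "bounded_bilinear B" "smooth_fun A W f" "smooth_fun A W g"
  shows "smooth_fun A W (\<lambda>y. B (f y) (g y))"
  using assms Ck_on_bounded_bilinear [OF open_chart_image]
  unfolding smooth_fun_def smooth_on_def comp_def by blast

lemma smooth_fun_add:
  assumes "open W" "smooth_fun A W f" "smooth_fun A W g"
  shows "smooth_fun A W (\<lambda>y. f y + g y)"
  using assms Ck_on_add [OF open_chart_image]
  unfolding smooth_fun_def smooth_on_def comp_def by blast

lemma smooth_fun_sum:
  assumes "open W" "finite I" "\<And>i. i \<in> I \<Longrightarrow> smooth_fun A W (f i)"
  shows "smooth_fun A W (\<lambda>y. \<Sum>i\<in>I. f i y)"
  using assms(2,3)
  by (induction I) (auto intro!: smooth_fun_add [OF \<open>open W\<close>] smooth_fun_const)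

lemma smooth_fun_vec:
  fixes f :: "'x \<Rightarrow> 'b::euclidean_space^'m"
  assumes "open W" "\<And>i. smooth_fun A W (\<lambda>y. f y $ i)"
  shows "smooth_fun A W f"
proof -
  have "smooth_fun A W (\<lambda>y. \<Sum>i\<in>UNIV. axis i (f y $ i))"
    by (intro smooth_fun_sum smooth_fun_bounded_linear [OF \<open>open W\<close> bounded_linear_axis] assms) auto
  then show ?thesis by (simp flip: vec_eq_sum_axis)
qed

lemma hol_fun_imp_smooth_fun: "open W \<Longrightarrow> hol_fun A W f \<Longrightarrow> smooth_fun A W f"
  unfolding hol_fun_def smooth_fun_def using hol_on_imp_smooth_on open_chart_image by blast

lemma smooth_fun_has_derivative:
  assumes "smooth_fun A W f" "c \<in> A" "y \<in> W" "y \<in> fst c"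
  shows "((f \<circ> chart_inv c) has_derivative frechet_derivative (f \<circ> chart_inv c) (at (snd c y)))
    (at (snd c y))"
proof (rule Ck_on_Suc_has_derivative)
  show "Ck_on (Suc 0) (f \<circ> chart_inv c) (snd c ` (W \<inter> fst c))"
    using assms unfolding smooth_fun_def smooth_on_def by blast
qed (use assms in auto)

section \<open>Coordinate fields\<close>

lemma transition_has_derivative:
  assumes "c \<in> A" "d \<in> A" "y \<in> fst c" "y \<in> fst d"
  obtains L where "((snd d \<circ> chart_inv c) has_derivative L) (at (snd c y))"
    "\<And>a v. L (a *s v) = a *s L v"
proof -
  have hol: "hol_on (\<lambda>z. snd d (chart_inv c z) $ i) (snd c ` (fst c \<inter> fst d))" for i
    using atlas assms unfolding complex_atlas_def by blast
  have y: "snd c y \<in> snd c ` (fst c \<inter> fst d)" using assms by blast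
  let ?L = "\<lambda>v. \<chi> i. frechet_derivative (\<lambda>z. snd d (chart_inv c z) $ i) (at (snd c y)) v"
  have "((snd d \<circ> chart_inv c) has_derivative ?L) (at (snd c y))"
    using hol_on_has_derivative(1) [OF hol y]
    by (intro has_derivative_vec_componentwise) (simp add: comp_def)
  moreover have "?L (a *s v) = a *s ?L v" for a v
    by (simp add: vec_eq_iff hol_on_has_derivative(2) [OF hol y])
  ultimately show ?thesis by (rule that)
qed

text \<open>Transition maps are holomorphic, so passing from a chart to the preferred one respects
  multiplication by \<open>i\<close>. This is what makes the notion of type independent of the
  chart.\<close>

lemma coord_field_has_derivative:
  assumes "c \<in> A" "y \<in> fst c"
  shows "((snd (chart_at A y) \<circ> chart_inv c) has_derivative (\<lambda>v. coord_field A c v y)) (at (snd c y))"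
    and "coord_field A c (a *s v) y = a *s coord_field A c v y"
proof -
  obtain L where L: "((snd (chart_at A y) \<circ> chart_inv c) has_derivative L) (at (snd c y))"
      "\<And>a v. L (a *s v) = a *s L v"
    using transition_has_derivative [OF assms(1) chart_at_in assms(2) in_chart_at] by blast
  have "L = (\<lambda>v. coord_field A c v y)"
    unfolding coord_field_def using frechet_derivative_at [OF L(1)] by simp
  with L show "((snd (chart_at A y) \<circ> chart_inv c) has_derivative (\<lambda>v. coord_field A c v y)) (at (snd c y))"
    "coord_field A c (a *s v) y = a *s coord_field A c v y" by metis+
qed

text \<open>The transition from a chart to itself is the identity. At its base point, the coordinate
  fields of the preferred chart therefore reproduce the tangent vectors.\<close>

lemma coord_field_chart_at: "coord_field A (chart_at A x) v x = v"
proof -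
  let ?c = "chart_at A x"
  have "((snd ?c \<circ> chart_inv ?c) has_derivative (\<lambda>v. v)) (at (snd ?c x))"
  proof (rule has_derivative_transform_within_open [OF has_derivative_ident])
    show "open (snd ?c ` (UNIV \<inter> fst ?c))" by (rule open_chart_image [OF chart_at_in open_UNIV])
    show "z = (snd ?c \<circ> chart_inv ?c) z" if "z \<in> snd ?c ` (UNIV \<inter> fst ?c)" for z
      using that chart_inv_chart [OF chart_at_in [of x]] by auto
  qed (use in_chart_at in auto)
  from frechet_derivative_at [OF this] show ?thesis unfolding coord_field_def by metis
qed

text \<open>Chain rule: near \<open>snd c y\<close> the local expression in \<open>c\<close> is the
  one in the preferred chart at \<open>y\<close> composed with the transition map, whose derivative
  is the coordinate field.\<close>

lemma coord_deriv_eq: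
  assumes W: "open W" "smooth_fun A W f" "y \<in> W" and c: "c \<in> A" "y \<in> fst c"
  shows "coord_deriv A c v f y = frechet_derivative (f \<circ> chart_inv c) (at (snd c y)) v"
proof -
  let ?d = "chart_at A y"
  have inv: "chart_inv c (snd c y) = y" by (rule chart_inv_chart [OF c])
  have D: "((f \<circ> chart_inv ?d) has_derivative differential A f y) (at (snd ?d y))"
    using smooth_fun_has_derivative [OF W(2) chart_at_in W(3) in_chart_at]
    unfolding differential_def by simp
  have "(((f \<circ> chart_inv ?d) \<circ> (snd ?d \<circ> chart_inv c)) has_derivative
      differential A f y \<circ> (\<lambda>v. coord_field A c v y)) (at (snd c y))"
    using coord_field_has_derivative(1) [OF c] D inv by (intro diff_chain_at) auto
  then have "((f \<circ> chart_inv c) has_derivative differential A f y \<circ> (\<lambda>v. coord_field A c v y))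
      (at (snd c y))"
  proof (rule has_derivative_transform_within_open)
    show "open (snd c ` (fst ?d \<inter> fst c))"
      by (rule open_chart_image [OF c(1) open_chart [OF chart_at_in]])
    show "snd c y \<in> snd c ` (fst ?d \<inter> fst c)" using in_chart_at c by blast
    show "((f \<circ> chart_inv ?d) \<circ> (snd ?d \<circ> chart_inv c)) z = (f \<circ> chart_inv c) z"
      if "z \<in> snd c ` (fst ?d \<inter> fst c)" for z
      using that chart_inv_chart [OF chart_at_in [of y]] chart_inv_chart [OF c(1)] by auto
  qed
  from frechet_derivative_at [OF this] show ?thesis unfolding coord_deriv_def by (metis comp_apply)
qed

lemma differential_eq_coord_deriv:
  "differential A f x v = coord_deriv A (chart_at A x) v f x"
  by (simp add: coord_deriv_def coord_field_chart_at)

lemma differential_cong: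
  assumes "open W" "smooth_fun A W f" "x \<in> W" "\<And>y. y \<in> W \<Longrightarrow> f y = g y"
  shows "differential A f x v = differential A g x v"
proof -
  let ?c = "chart_at A x"
  have "((g \<circ> chart_inv ?c) has_derivative frechet_derivative (f \<circ> chart_inv ?c) (at (snd ?c x)))
      (at (snd ?c x))"
    using smooth_fun_has_derivative [OF assms(2) chart_at_in assms(3) in_chart_at]
  proof (rule has_derivative_transform_within_open)
    show "open (snd ?c ` (W \<inter> fst ?c))" by (rule open_chart_image [OF chart_at_in assms(1)])
  qed (use assms(3,4) in_chart_at chart_inv_chart [OF chart_at_in [of x]] in auto)
  from frechet_derivative_at [OF this] show ?thesis unfolding differential_def by simp
qed

lemma differential_add:
  assumes "smooth_fun A W f" "smooth_fun A W g" "x \<in> W"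
  shows "differential A (\<lambda>y. f y + g y) x v = differential A f x v + differential A g x v"
proof -
  let ?c = "chart_at A x"
  have "(((\<lambda>y. f y + g y) \<circ> chart_inv ?c) has_derivative
      (\<lambda>v. differential A f x v + differential A g x v)) (at (snd ?c x))"
    using has_derivative_add [OF smooth_fun_has_derivative [OF assms(1) chart_at_in assms(3) in_chart_at]
        smooth_fun_has_derivative [OF assms(2) chart_at_in assms(3) in_chart_at]]
    by (simp add: differential_def comp_def)
  from frechet_derivative_at [OF this] show ?thesis by (metis differential_def)
qed

lemma differential_const: "differential A (\<lambda>y. k) x v = 0"
  by (simp add: differential_def comp_def)

lemma differential_holomorphic:
  fixes f :: "'x \<Rightarrow> complex^'m"
  assumes "\<And>i. hol_fun A W (\<lambda>y. f y $ i)" "x \<in> W"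
  shows "differential A f x (a *s v) = a *s differential A f x v"
proof -
  let ?c = "chart_at A x"
  have x: "snd ?c x \<in> snd ?c ` (W \<inter> fst ?c)" using assms(2) in_chart_at by blast
  have hol: "hol_on ((\<lambda>y. f y $ i) \<circ> chart_inv ?c) (snd ?c ` (W \<inter> fst ?c))" for i
    using assms(1) chart_at_in unfolding hol_fun_def by blast
  let ?L = "\<lambda>v. \<chi> i. frechet_derivative ((\<lambda>y. f y $ i) \<circ> chart_inv ?c) (at (snd ?c x)) v"
  have "((f \<circ> chart_inv ?c) has_derivative ?L) (at (snd ?c x))"
    using hol_on_has_derivative(1) [OF hol x]
    by (intro has_derivative_vec_componentwise) (simp add: comp_def)
  then have "differential A f x = ?L"
    unfolding differential_def using frechet_derivative_at by fastforce
  then show ?thesis by (simp add: vec_eq_iff hol_on_has_derivative(2) [OF hol x])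
qed

text \<open>Coordinate fields of one chart commute. The first derivative is identified with a
  partial derivative throughout a neighbourhood of \<open>x\<close>, so it can be differentiated
  again in the same chart.\<close>

lemma coord_deriv_symmetric:
  assumes W: "open W" "smooth_fun A W f" "x \<in> W" and c: "c = chart_at A x"
  shows "differential A (coord_deriv A c v f) x u = differential A (coord_deriv A c u f) x v"
proof -
  let ?f = "f \<circ> chart_inv c" and ?S = "snd c ` (W \<inter> fst c)"
  have cA: "c \<in> A" "x \<in> fst c" unfolding c by (rule chart_at_in, rule in_chart_at)
  have S: "open ?S" "snd c x \<in> ?S" using open_chart_image [OF cA(1) W(1)] W(3) cA(2) by auto
  have "Ck_on (Suc (Suc 0)) ?f ?S"
    using W(2) cA(1) unfolding smooth_fun_def smooth_on_def by blast
  then have f: "\<And>z. z \<in> ?S \<Longrightarrow> ?f differentiable (at z)"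
    and f': "\<And>z w. z \<in> ?S \<Longrightarrow> (\<lambda>z. frechet_derivative ?f (at z) w) differentiable (at z)"
    by auto
  have eq: "differential A (coord_deriv A c w f) x w'
      = frechet_derivative (\<lambda>z. frechet_derivative ?f (at z) w) (at (snd c x)) w'" for w w'
  proof -
    have "frechet_derivative (\<lambda>z. frechet_derivative ?f (at z) w) (at (snd c x))
        = frechet_derivative (coord_deriv A c w f \<circ> chart_inv c) (at (snd c x))"
    proof (rule frechet_derivative_transform_within_open [OF f' [OF S(2)] S])
      fix z assume "z \<in> ?S"
      then obtain y where y: "y \<in> W" "y \<in> fst c" "z = snd c y" by blast
      then show "frechet_derivative ?f (at z) w = (coord_deriv A c w f \<circ> chart_inv c) z"
        by (simp add: chart_inv_chart [OF cA(1)] coord_deriv_eq [OF W(1,2) _ cA(1)])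
    qed
    then show ?thesis unfolding differential_def c by simp
  qed
  show ?thesis unfolding eq by (rule frechet_derivative_symmetric [OF S f f' [OF S(2)]])
qed

end

section \<open>Sections of holomorphic vector bundles\<close>

locale holomorphic_vector_bundle = complex_manifold A
  for A :: "('x::t2_space, 'n::finite) chart set" +
  fixes T :: "('x, 'r::finite) triv set"
  assumes holo_bundle: "holomorphic_bundle A T"
begin

lemma triv_around: obtains t where "t \<in> T" "x \<in> fst t"
  using holo_bundle unfolding holomorphic_bundle_def by blast

lemma open_triv: "t \<in> T \<Longrightarrow> open (fst t)"
  using holo_bundle unfolding holomorphic_bundle_def by blast

lemma triv_inverse:
  assumes "t \<in> T" "y \<in> fst t"
  shows "snd t y *v (matrix_inv (snd t y) *v w) = w" "matrix_inv (snd t y) *v (snd t y *v w) = w"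
proof -
  have "invertible (snd t y)" using holo_bundle assms unfolding holomorphic_bundle_def by blast
  then have "snd t y ** matrix_inv (snd t y) = mat 1 \<and> matrix_inv (snd t y) ** snd t y = mat 1"
    unfolding invertible_def matrix_inv_def by (rule someI_ex)
  then show "snd t y *v (matrix_inv (snd t y) *v w) = w" "matrix_inv (snd t y) *v (snd t y *v w) = w"
    by (simp_all add: matrix_vector_mul_assoc)
qed

lemma smooth_section_subset: "smooth_section A T W s \<Longrightarrow> V \<subseteq> W \<Longrightarrow> smooth_section A T V s"
  unfolding smooth_section_def by (meson smooth_fun_subset Int_mono order_refl)

lemma smooth_section_cong:
  assumes "open W" "\<And>y. y \<in> W \<Longrightarrow> s y = s' y" "smooth_section A T W s"
  shows "smooth_section A T W s'"
  unfolding smooth_section_def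
proof
  fix t assume t: "t \<in> T"
  show "smooth_fun A (W \<inter> fst t) (\<lambda>y. snd t y *v s' y)"
  proof (rule smooth_fun_cong)
    show "smooth_fun A (W \<inter> fst t) (\<lambda>y. snd t y *v s y)"
      using assms(3) t unfolding smooth_section_def by blast
  qed (use assms open_triv [OF t] in auto)
qed

lemma smooth_section_add:
  assumes "open W" "smooth_section A T W s" "smooth_section A T W s'"
  shows "smooth_section A T W (\<lambda>y. s y + s' y)"
  using assms unfolding smooth_section_def
  by (auto simp: matrix_vector_right_distrib intro!: smooth_fun_add open_triv)

lemma smooth_section_smult:
  assumes "open W" "smooth_fun A W f" "smooth_section A T W s"
  shows "smooth_section A T W (\<lambda>y. f y *s s y)"
  unfolding smooth_section_def
proof
  fix t assume t: "t \<in> T"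
  have "smooth_fun A (W \<inter> fst t) (\<lambda>y. f y *s (snd t y *v s y))"
    using assms open_triv [OF t] t unfolding smooth_section_def
    by (intro smooth_fun_bounded_bilinear [OF _ bounded_bilinear_complex_smult])
       (auto intro: smooth_fun_subset)
  then show "smooth_fun A (W \<inter> fst t) (\<lambda>y. snd t y *v (f y *s s y))"
    by (simp add: vector_scalar_commute)
qed

text \<open>In the frame of \<open>t\<close> the endomorphism becomes its conjugate by
  \<open>snd t y\<close>, and this matrix multiplies the components of \<open>s\<close>.\<close>

lemma smooth_section_End:
  assumes "open W" "smooth_section A T W s"
    and P: "\<And>t. t \<in> T \<Longrightarrow> smooth_fun A (W \<inter> fst t) (\<lambda>y. snd t y ** P y ** matrix_inv (snd t y))"
  shows "smooth_section A T W (\<lambda>y. P y *v s y)"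
  unfolding smooth_section_def
proof
  fix t assume t: "t \<in> T"
  have "smooth_fun A (W \<inter> fst t) (\<lambda>y. (snd t y ** P y ** matrix_inv (snd t y)) *v (snd t y *v s y))"
  proof (rule smooth_fun_bounded_bilinear [OF _ bounded_bilinear_matrix_vector])
    show "open (W \<inter> fst t)" using assms(1) open_triv [OF t] by blast
    show "smooth_fun A (W \<inter> fst t) (\<lambda>y. snd t y *v s y)"
      using assms(2) t unfolding smooth_section_def by blast
  qed (rule P [OF t])
  then show "smooth_fun A (W \<inter> fst t) (\<lambda>y. snd t y *v (P y *v s y))"
    by (rule smooth_fun_cong [rotated 2])
       (use assms(1) open_triv [OF t] triv_inverse [OF t] in
         \<open>auto simp flip: matrix_vector_mul_assoc\<close>)
qed

text \<open>For \<open>w = axis j 1\<close> these are the members of the holomorphic frame that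
  belongs to \<open>t\<close>.\<close>

definition constant_section :: "('x, 'r) triv \<Rightarrow> complex^'r \<Rightarrow> 'x \<Rightarrow> complex^'r" where
  "constant_section t w y = matrix_inv (snd t y) *v w"

text \<open>In another trivialisation the components are a transition matrix applied to
  \<open>w\<close>. Here smoothness of holomorphic functions is indispensable.\<close>

lemma smooth_constant_section:
  assumes "t \<in> T"
  shows "smooth_section A T (fst t) (constant_section t w)"
  unfolding smooth_section_def
proof
  fix t' assume t': "t' \<in> T"
  have op: "open (fst t \<inter> fst t')" using open_triv assms t' by blast
  have "hol_fun A (fst t \<inter> fst t') (\<lambda>x. (snd t' x ** matrix_inv (snd t x)) $ i $ j)" for i j
    using holo_bundle assms t' unfolding holomorphic_bundle_def by blast
  then have "smooth_fun A (fst t \<inter> fst t') (\<lambda>x. snd t' x ** matrix_inv (snd t x))"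
    by (intro smooth_fun_vec [OF op] hol_fun_imp_smooth_fun [OF op])
  then have "smooth_fun A (fst t \<inter> fst t') (\<lambda>x. (snd t' x ** matrix_inv (snd t x)) *v w)"
    by (intro smooth_fun_bounded_bilinear [OF op bounded_bilinear_matrix_vector] smooth_fun_const)
  then show "smooth_fun A (fst t \<inter> fst t') (\<lambda>x. snd t' x *v constant_section t w x)"
    by (simp add: constant_section_def matrix_vector_mul_assoc)
qed

lemma constant_section_expansion:
  assumes "t \<in> T" "y \<in> fst t"
  shows "a = (\<Sum>j\<in>UNIV. (snd t y *v a) $ j *s constant_section t (axis j 1) y)"
proof -
  have "matrix_inv (snd t y) *v w = (\<Sum>j\<in>UNIV. w $ j *s constant_section t (axis j 1) y)" for w
    unfolding constant_section_def
    by (simp add: vec_eq_iff matrix_vector_mult_def axis_def if_distrib mult.commute cong: if_cong)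
  from this [of "snd t y *v a"] show ?thesis by (simp add: triv_inverse [OF assms])
qed

section \<open>Tensoriality: operators on sections given by a matrix\<close>

lemma coefficient_smooth:
  assumes "open W" "smooth_section A T W s" "t \<in> T"
  shows "smooth_fun A (W \<inter> fst t) (\<lambda>y. (snd t y *v s y) $ j)"
  using assms open_triv [OF assms(3)] unfolding smooth_section_def
  by (intro smooth_fun_bounded_linear [OF _ bounded_linear_vec_nth]) auto

text \<open>Near \<open>x\<close> a section is a combination of frame members with smooth
  coefficients. Locality and linearity over functions then express \<open>L s\<close> by the values
  of the coefficients at \<open>x\<close> alone. The open set varies in the hypotheses because the
  expansion holds only on a trivialising neighbourhood.\<close>

lemma tensorial_operator:
  fixes L :: "('x \<Rightarrow> complex^'r) \<Rightarrow> complex^'r"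
  assumes cong: "\<And>W s s'. open W \<Longrightarrow> x \<in> W \<Longrightarrow> smooth_section A T W s \<Longrightarrow> smooth_section A T W s' \<Longrightarrow>
      (\<And>y. y \<in> W \<Longrightarrow> s y = s' y) \<Longrightarrow> L s = L s'"
    and add: "\<And>W s s'. open W \<Longrightarrow> x \<in> W \<Longrightarrow> smooth_section A T W s \<Longrightarrow> smooth_section A T W s' \<Longrightarrow>
      L (\<lambda>y. s y + s' y) = L s + L s'"
    and mult: "\<And>W f s. open W \<Longrightarrow> x \<in> W \<Longrightarrow> smooth_fun A W f \<Longrightarrow> smooth_section A T W s \<Longrightarrow>
      L (\<lambda>y. f y *s s y) = f x *s L s"
  shows "\<exists>M. \<forall>W s. open W \<longrightarrow> x \<in> W \<longrightarrow> smooth_section A T W s \<longrightarrow> M *v s x = L s"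
proof -
  obtain t where t: "t \<in> T" "x \<in> fst t" by (rule triv_around)
  let ?e = "\<lambda>j. constant_section t (axis j 1)"
  \<comment> \<open>The columns of \<open>N\<close> are the images of the frame;
    \<open>snd t x\<close> first converts a vector into its frame components.\<close>
  define N where "N = (\<chi> i j. L (?e j) $ i)"
  have "(N ** snd t x) *v s x = L s" if W: "open W" "x \<in> W" "smooth_section A T W s" for W s
  proof -
    let ?U = "W \<inter> fst t" and ?f = "\<lambda>j y. (snd t y *v s y) $ j"
    have U: "open ?U" "x \<in> ?U" using W t(2) open_triv [OF t(1)] by auto
    have f: "smooth_fun A ?U (?f j)" for j by (rule coefficient_smooth [OF W(1,3) t(1)])
    have e: "smooth_section A T ?U (?e j)" for j
      by (rule smooth_section_subset [OF smooth_constant_section [OF t(1)]]) simp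
    have fe: "smooth_section A T ?U (\<lambda>y. ?f j y *s ?e j y)" for j
      by (rule smooth_section_smult [OF U(1) f e])
    have zero: "smooth_section A T ?U (\<lambda>y. 0)"
      using smooth_section_smult [OF U(1) smooth_fun_const [of _ 0] e [of undefined]] by simp
    have L0: "L (\<lambda>y. 0) = 0"
      using mult [OF U smooth_fun_const [of _ 0] zero] by simp
    \<comment> \<open>Smoothness of the partial sums is carried through the induction because
      additivity of \<open>L\<close> is available for smooth sections.\<close>
    have "smooth_section A T ?U (\<lambda>y. \<Sum>j\<in>J. ?f j y *s ?e j y) \<and>
        L (\<lambda>y. \<Sum>j\<in>J. ?f j y *s ?e j y) = (\<Sum>j\<in>J. ?f j x *s L (?e j))" if "finite J" for J
      using that
    proof (induction J)
      case empty
      show ?case using zero L0 by simp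
    next
      case (insert j J)
      then show ?case
        using smooth_section_add [OF U(1) fe] add [OF U fe] mult [OF U f e] by simp
    qed
    note sum = this [OF finite [of UNIV]]
    have "L s = L (\<lambda>y. \<Sum>j\<in>UNIV. ?f j y *s ?e j y)"
    proof (rule cong [OF U])
      show "smooth_section A T ?U s" by (rule smooth_section_subset [OF W(3)]) simp
      show "s y = (\<Sum>j\<in>UNIV. ?f j y *s ?e j y)" if "y \<in> ?U" for y
        using that by (intro constant_section_expansion [OF t(1)]) auto
    qed (use sum in blast)
    also have "\<dots> = N *v (snd t x *v s x)"
      using sum by (simp add: N_def matrix_mult_sum column_def)
    finally show ?thesis by (simp add: matrix_vector_mul_assoc)
  qed
  then show ?thesis by blast
qed

lemma section_through:
  obtains W s where "open W" "x \<in> W" "smooth_section A T W s" "s x = a"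
proof -
  obtain t where t: "t \<in> T" "x \<in> fst t" by (rule triv_around)
  show ?thesis
    by (rule that [OF open_triv [OF t(1)] t(2) smooth_constant_section [OF t(1), of "snd t x *v a"]])
       (simp add: constant_section_def triv_inverse [OF t])
qed

lemma matrix_eq_on_sections:
  assumes "\<And>W s. open W \<Longrightarrow> x \<in> W \<Longrightarrow> smooth_section A T W s \<Longrightarrow> M *v s x = N *v s x"
  shows "M = N"
  unfolding matrix_eq
proof
  fix a show "M *v a = N *v a" using assms section_through [of x a] by metis
qed

text \<open>This makes the definitions by \<open>THE\<close> usable: tensoriality supplies
  existence, and uniqueness holds because every vector of the fibre is the value of a local smooth
  section.\<close>

lemma The_matrix_on_sections:
  assumes "\<exists>M. \<forall>W s. open W \<longrightarrow> x \<in> W \<longrightarrow> smooth_section A T W s \<longrightarrow> M *v s x = L s"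
    and "open W" "x \<in> W" "smooth_section A T W s"
  shows "(THE M. \<forall>W s. open W \<longrightarrow> x \<in> W \<longrightarrow> smooth_section A T W s \<longrightarrow> M *v s x = L s) *v s x = L s"
proof -
  let ?P = "\<lambda>M. \<forall>W s. open W \<longrightarrow> x \<in> W \<longrightarrow> smooth_section A T W s \<longrightarrow> M *v s x = L s"
  have "\<exists>!M. ?P M"
    using assms(1) by (rule ex_ex1I) (rule matrix_eq_on_sections [of x], simp)
  from theI' [OF this] show ?thesis using assms by blast
qed

end

section \<open>Connections\<close>

locale bundle_connection = holomorphic_vector_bundle A T
  for A :: "('x::t2_space, 'n::finite) chart set" and T :: "('x, 'r::finite) triv set" +
  fixes D :: "('x \<Rightarrow> complex^'r) \<Rightarrow> 'x \<Rightarrow> complex^'n \<Rightarrow> complex^'r"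
  assumes connection: "connection A T D"
begin

text \<open>Covariant derivative along a coordinate field. Unlike \<open>D s y v\<close> with
  \<open>v\<close> fixed, it is a smooth section on the chart domain and can be differentiated
  again.\<close>

definition nabla :: "('x, 'n) chart \<Rightarrow> complex^'n \<Rightarrow> ('x \<Rightarrow> complex^'r) \<Rightarrow> 'x \<Rightarrow> complex^'r" where
  "nabla c v s = (\<lambda>y. D s y (coord_field A c v y))"

lemma nabla_chart_at: "nabla (chart_at A x) v s x = D s x v"
  by (simp add: nabla_def coord_field_chart_at)

lemma smooth_nabla:
  assumes "open W" "smooth_section A T W s" "c \<in> A"
  shows "smooth_section A T (W \<inter> fst c) (nabla c v s)"
proof -
  have "smooth_form1 A T W (D s)"
    using connection [unfolded connection_def, THEN conjunct1] assms(1,2) by simp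
  from this [unfolded smooth_form1_def, THEN conjunct2, rule_format, OF assms(3)]
  show ?thesis unfolding nabla_def .
qed

lemma nabla_cong:
  assumes "open W" "smooth_section A T W s" "smooth_section A T W s'"
    "\<And>y. y \<in> W \<Longrightarrow> s y = s' y" "y \<in> W"
  shows "nabla c v s y = nabla c v s' y"
proof -
  have "D s y = D s' y"
    by (rule connection [unfolded connection_def, THEN conjunct2, THEN conjunct1, rule_format, OF assms])
  then show ?thesis by (simp add: nabla_def)
qed

lemma nabla_add:
  assumes "open W" "smooth_section A T W s" "smooth_section A T W s'" "y \<in> W"
  shows "nabla c v (\<lambda>y. s y + s' y) y = nabla c v s y + nabla c v s' y"
  unfolding nabla_def
  by (rule connection [unfolded connection_def, THEN conjunct2, THEN conjunct2, THEN conjunct1,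
        rule_format, OF assms])

lemma nabla_smult:
  assumes "open W" "smooth_fun A W f" "smooth_section A T W s" "y \<in> W"
  shows "nabla c v (\<lambda>y. f y *s s y) y = coord_deriv A c v f y *s s y + f y *s nabla c v s y"
  unfolding nabla_def coord_deriv_def
  by (rule connection [unfolded connection_def, THEN conjunct2, THEN conjunct2, THEN conjunct2,
        rule_format, OF assms])

lemma nabla_smult_const:
  assumes "open W" "smooth_section A T W s" "y \<in> W"
  shows "nabla c v (\<lambda>y. a *s s y) y = a *s nabla c v s y"
  using nabla_smult [OF assms(1) smooth_fun_const [of W a] assms(2,3)]
  by (simp add: coord_deriv_def differential_const)

text \<open>The Leibniz rule recovers the derivative of a function from derivatives of smooth sections, so
  that its smoothness needs no chain rule for the change of coordinates.\<close>

lemma smooth_coord_deriv: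
  fixes f :: "'x \<Rightarrow> complex"
  assumes W: "open W" "smooth_fun A W f" and c: "c \<in> A" and t: "t \<in> T"
  shows "smooth_fun A (W \<inter> fst c \<inter> fst t) (coord_deriv A c v f)"
proof -
  let ?U = "W \<inter> fst t" and ?V = "W \<inter> fst c \<inter> fst t"
  \<comment> \<open>An arbitrary index: one nowhere vanishing frame member suffices to read off the
    scalar factor.\<close>
  define k :: 'r where "k = undefined"
  let ?e = "constant_section t (axis k 1)"
  have U: "open ?U" and V: "open ?V" using W(1) open_triv [OF t] open_chart [OF c] by auto
  have e: "smooth_section A T ?U ?e"
    by (rule smooth_section_subset [OF smooth_constant_section [OF t]]) simp
  have f: "smooth_fun A ?U f" by (rule smooth_fun_subset [OF W(2)]) simp
  have fe: "smooth_section A T ?U (\<lambda>y. f y *s ?e y)" by (rule smooth_section_smult [OF U f e])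
  have *: "smooth_section A T ?V (nabla c v (\<lambda>y. f y *s ?e y))" "smooth_section A T ?V (nabla c v ?e)"
    using smooth_nabla [OF U _ c] fe e by (auto intro: smooth_section_subset)
  have "smooth_section A T ?V (\<lambda>y. nabla c v (\<lambda>y. f y *s ?e y) y + (-1) *s (f y *s nabla c v ?e y))"
    by (intro smooth_section_add smooth_section_smult V * smooth_fun_const smooth_fun_subset [OF W(2)]) auto
  then have "smooth_section A T ?V (\<lambda>y. coord_deriv A c v f y *s ?e y)"
  proof (rule smooth_section_cong [OF V, rotated])
    fix y assume "y \<in> ?V"
    then show "nabla c v (\<lambda>y. f y *s ?e y) y + (-1) *s (f y *s nabla c v ?e y)
        = coord_deriv A c v f y *s ?e y"
      by (simp add: nabla_smult [OF U f e])
  qed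
  from coefficient_smooth [OF V this t]
  have "smooth_fun A ?V (\<lambda>y. (snd t y *v (coord_deriv A c v f y *s ?e y)) $ k)"
    by (simp add: Int_assoc)
  then show ?thesis
    by (rule smooth_fun_cong [OF V, rotated])
       (simp add: vector_scalar_commute constant_section_def triv_inverse [OF t])
qed

text \<open>The commutator of two covariant derivatives along commuting fields is tensorial. For
  \<open>f s\<close> the terms with one derivative on each factor are symmetric in \<open>u\<close>
  and \<open>v\<close> and cancel; those with two derivatives of \<open>f\<close> cancel by
  \<open>coord_deriv_symmetric\<close>.\<close>

lemma curvature_eq:
  assumes W: "open W" "x \<in> W" "smooth_section A T W s" and c: "c = chart_at A x"
  shows "curvature A T D x u v *v s x = nabla c u (nabla c v s) x - nabla c v (nabla c u s) x"
proof -
  have cA: "c \<in> A" "x \<in> fst c" unfolding c by (rule chart_at_in, rule in_chart_at)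
  have L: "ext_deriv1 A D (D s) x u v = nabla c u (nabla c v s) x - nabla c v (nabla c u s) x" for s
    by (simp add: ext_deriv1_def nabla_def c coord_field_chart_at)
  have "\<exists>M. \<forall>W s. open W \<longrightarrow> x \<in> W \<longrightarrow> smooth_section A T W s \<longrightarrow> M *v s x = ext_deriv1 A D (D s) x u v"
    unfolding L
  proof (rule tensorial_operator)
    fix W s s'
    assume W: "open W" "x \<in> W" and s: "smooth_section A T W s" and s': "smooth_section A T W s'"
    have V: "open (W \<inter> fst c)" "x \<in> W \<inter> fst c" using W open_chart [OF cA(1)] cA(2) by auto
    note sm = smooth_nabla [OF W(1) _ cA(1)]
    { assume eq: "\<And>y. y \<in> W \<Longrightarrow> s y = s' y"
      have "nabla c u (nabla c v s) x = nabla c u (nabla c v s') x" for u v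
        using nabla_cong [OF W(1) s s' eq]
        by (intro nabla_cong [OF V(1) sm [OF s] sm [OF s'] _ V(2)]) auto
      then show "nabla c u (nabla c v s) x - nabla c v (nabla c u s) x =
          nabla c u (nabla c v s') x - nabla c v (nabla c u s') x" by simp }
    have "nabla c u (nabla c v (\<lambda>y. s y + s' y)) x
        = nabla c u (\<lambda>y. nabla c v s y + nabla c v s' y) x" for u v
      using nabla_add [OF W(1) s s']
      by (intro nabla_cong [OF V(1) sm [OF smooth_section_add [OF W(1) s s']]
            smooth_section_add [OF V(1) sm [OF s] sm [OF s']] _ V(2)]) auto
    then show "nabla c u (nabla c v (\<lambda>y. s y + s' y)) x - nabla c v (nabla c u (\<lambda>y. s y + s' y)) x =
        (nabla c u (nabla c v s) x - nabla c v (nabla c u s) x) +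
        (nabla c u (nabla c v s') x - nabla c v (nabla c u s') x)"
      by (simp add: nabla_add [OF V(1) sm [OF s] sm [OF s'] V(2)])
  next
    fix W s and f :: "'x \<Rightarrow> complex"
    assume W: "open W" "x \<in> W" and f: "smooth_fun A W f" and s: "smooth_section A T W s"
    \<comment> \<open>The derivatives of \<open>f\<close> appear as coefficients that are
      differentiated again, and their smoothness is available inside a trivialisation.\<close>
    obtain t where t: "t \<in> T" "x \<in> fst t" by (rule triv_around)
    let ?V = "W \<inter> fst c \<inter> fst t"
    have V: "open ?V" "x \<in> ?V" using W open_chart [OF cA(1)] open_triv [OF t(1)] cA t by auto
    have sV: "smooth_section A T ?V s" by (rule smooth_section_subset [OF s]) auto
    have fV: "smooth_fun A ?V f" by (rule smooth_fun_subset [OF f]) auto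
    have df: "smooth_fun A ?V (coord_deriv A c w f)" for w
      by (rule smooth_coord_deriv [OF W(1) f cA(1) t(1)])
    have sm: "smooth_section A T ?V (nabla c w s)" if "smooth_section A T W s" for w s
      by (rule smooth_section_subset [OF smooth_nabla [OF W(1) that cA(1)]]) auto
    have 1: "smooth_section A T ?V (\<lambda>y. coord_deriv A c w f y *s s y)"
      and 2: "smooth_section A T ?V (\<lambda>y. f y *s nabla c w s y)" for w
      by (rule smooth_section_smult [OF V(1) df sV], rule smooth_section_smult [OF V(1) fV sm [OF s]])
    have dc: "differential A g x w = coord_deriv A c w g x" for g :: "'x \<Rightarrow> complex" and w
      unfolding c by (rule differential_eq_coord_deriv)
    have "nabla c u (nabla c v (\<lambda>y. f y *s s y)) x
        = nabla c u (\<lambda>y. coord_deriv A c v f y *s s y + f y *s nabla c v s y) x" for u v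
      using nabla_smult [OF W(1) f s]
      by (intro nabla_cong [OF V(1) sm [OF smooth_section_smult [OF W(1) f s]]
            smooth_section_add [OF V(1) 1 2] _ V(2)]) auto
    also have "nabla c u (\<lambda>y. coord_deriv A c v f y *s s y + f y *s nabla c v s y) x
        = differential A (coord_deriv A c v f) x u *s s x + coord_deriv A c v f x *s nabla c u s x
          + (coord_deriv A c u f x *s nabla c v s x + f x *s nabla c u (nabla c v s) x)" for u v
      by (simp add: nabla_add [OF V(1) 1 2 V(2)] nabla_smult [OF V(1) df sV V(2)]
          nabla_smult [OF V(1) fV sm [OF s] V(2)] dc)
    finally have eq: "nabla c u (nabla c v (\<lambda>y. f y *s s y)) x
        = differential A (coord_deriv A c v f) x u *s s x + coord_deriv A c v f x *s nabla c u s x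
          + (coord_deriv A c u f x *s nabla c v s x + f x *s nabla c u (nabla c v s) x)" for u v .
    show "nabla c u (nabla c v (\<lambda>y. f y *s s y)) x - nabla c v (nabla c u (\<lambda>y. f y *s s y)) x
        = f x *s (nabla c u (nabla c v s) x - nabla c v (nabla c u s) x)"
      unfolding eq coord_deriv_symmetric [OF W(1) f W(2) c, of v u]
      by (simp add: vector_ssub_ldistrib)
  qed
  from The_matrix_on_sections [OF this W]
  show ?thesis unfolding curvature_def by (simp add: L)
qed

definition End_component ::
    "('x \<Rightarrow> complex^'n \<Rightarrow> complex^'r^'r) \<Rightarrow> ('x, 'n) chart \<Rightarrow> complex^'n \<Rightarrow> 'x \<Rightarrow> complex^'r^'r" where
  "End_component \<Psi> c v y = \<Psi> y (coord_field A c v y)"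

lemma smooth_End_component:
  assumes "smooth_End_form1 A T \<Psi>" "open W" "smooth_section A T W s" "c \<in> A" "W \<subseteq> fst c"
  shows "smooth_section A T W (\<lambda>y. End_component \<Psi> c v y *v s y)"
proof (rule smooth_section_End [OF assms(2,3)])
  fix t assume "t \<in> T"
  then have "smooth_fun A (fst c \<inter> fst t)
      (\<lambda>y. snd t y ** \<Psi> y (coord_field A c v y) ** matrix_inv (snd t y))"
    using assms(1,4) unfolding smooth_End_form1_def by blast
  then show "smooth_fun A (W \<inter> fst t) (\<lambda>y. snd t y ** End_component \<Psi> c v y ** matrix_inv (snd t y))"
    unfolding End_component_def by (rule smooth_fun_subset) (use assms(5) in auto)
qed

text \<open>Tensoriality again: the derivatives of \<open>f\<close> that arise in
  \<open>D(\<Psi>(f s))\<close> are cancelled by those in \<open>\<Psi> \<and> D(f s)\<close>, which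
  is the purpose of the second term in the definition.\<close>

lemma cov_deriv_End_eq:
  assumes \<Psi>: "smooth_End_form1 A T \<Psi>"
    and W: "open W" "x \<in> W" "smooth_section A T W s" and c: "c = chart_at A x"
  shows "cov_deriv_End A T D \<Psi> x u v *v s x =
    nabla c u (\<lambda>y. End_component \<Psi> c v y *v s y) x - nabla c v (\<lambda>y. End_component \<Psi> c u y *v s y) x +
    (\<Psi> x u *v nabla c v s x - \<Psi> x v *v nabla c u s x)"
proof -
  have cA: "c \<in> A" "x \<in> fst c" unfolding c by (rule chart_at_in, rule in_chart_at)
  let ?E = "End_component \<Psi> c"
  have E_x: "?E w x = \<Psi> x w" for w by (simp add: End_component_def c coord_field_chart_at)
  have L: "ext_deriv1 A D (\<lambda>y w. \<Psi> y w *v s y) x u v + (\<Psi> x u *v D s x v - \<Psi> x v *v D s x u)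
      = nabla c u (\<lambda>y. ?E v y *v s y) x - nabla c v (\<lambda>y. ?E u y *v s y) x +
        (\<Psi> x u *v nabla c v s x - \<Psi> x v *v nabla c u s x)" for s
    by (simp add: ext_deriv1_def nabla_def c coord_field_chart_at End_component_def)
  have "\<exists>M. \<forall>W s. open W \<longrightarrow> x \<in> W \<longrightarrow> smooth_section A T W s \<longrightarrow> M *v s x =
      ext_deriv1 A D (\<lambda>y w. \<Psi> y w *v s y) x u v + (\<Psi> x u *v D s x v - \<Psi> x v *v D s x u)"
    unfolding L
  proof (rule tensorial_operator)
    fix W s s'
    assume W: "open W" "x \<in> W" and s0: "smooth_section A T W s" and s0': "smooth_section A T W s'"
    let ?V = "W \<inter> fst c"
    have V: "open ?V" "x \<in> ?V" using W open_chart [OF cA(1)] cA(2) by auto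
    have s: "smooth_section A T ?V s" and s': "smooth_section A T ?V s'"
      by (auto intro: smooth_section_subset s0 s0')
    note sm = smooth_End_component [OF \<Psi> V(1) _ cA(1) Int_lower2]
    { assume eq: "\<And>y. y \<in> W \<Longrightarrow> s y = s' y"
      have "nabla c u (\<lambda>y. ?E v y *v s y) x = nabla c u (\<lambda>y. ?E v y *v s' y) x" for u v
        using eq by (intro nabla_cong [OF V(1) sm [OF s] sm [OF s'] _ V(2)]) auto
      moreover have "nabla c u s x = nabla c u s' x" for u
        using nabla_cong [OF W(1) s0 s0' eq W(2)] .
      ultimately show "nabla c u (\<lambda>y. ?E v y *v s y) x - nabla c v (\<lambda>y. ?E u y *v s y) x +
          (\<Psi> x u *v nabla c v s x - \<Psi> x v *v nabla c u s x)
        = nabla c u (\<lambda>y. ?E v y *v s' y) x - nabla c v (\<lambda>y. ?E u y *v s' y) x +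
          (\<Psi> x u *v nabla c v s' x - \<Psi> x v *v nabla c u s' x)" by simp }
    show "nabla c u (\<lambda>y. ?E v y *v (s y + s' y)) x - nabla c v (\<lambda>y. ?E u y *v (s y + s' y)) x +
        (\<Psi> x u *v nabla c v (\<lambda>y. s y + s' y) x - \<Psi> x v *v nabla c u (\<lambda>y. s y + s' y) x)
      = nabla c u (\<lambda>y. ?E v y *v s y) x - nabla c v (\<lambda>y. ?E u y *v s y) x +
          (\<Psi> x u *v nabla c v s x - \<Psi> x v *v nabla c u s x) +
        (nabla c u (\<lambda>y. ?E v y *v s' y) x - nabla c v (\<lambda>y. ?E u y *v s' y) x +
          (\<Psi> x u *v nabla c v s' x - \<Psi> x v *v nabla c u s' x))"
      by (simp add: matrix_vector_right_distrib nabla_add [OF V(1) s s' V(2)]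
          nabla_add [OF V(1) sm [OF s] sm [OF s'] V(2)])
  next
    fix W s and f :: "'x \<Rightarrow> complex"
    assume W: "open W" "x \<in> W" and f0: "smooth_fun A W f" and s0: "smooth_section A T W s"
    let ?V = "W \<inter> fst c"
    have V: "open ?V" "x \<in> ?V" using W open_chart [OF cA(1)] cA(2) by auto
    have s: "smooth_section A T ?V s" by (rule smooth_section_subset [OF s0]) auto
    have f: "smooth_fun A ?V f" by (rule smooth_fun_subset [OF f0]) auto
    note sm = smooth_End_component [OF \<Psi> V(1) _ cA(1) Int_lower2]
    show "nabla c u (\<lambda>y. ?E v y *v (f y *s s y)) x - nabla c v (\<lambda>y. ?E u y *v (f y *s s y)) x +
        (\<Psi> x u *v nabla c v (\<lambda>y. f y *s s y) x - \<Psi> x v *v nabla c u (\<lambda>y. f y *s s y) x)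
      = f x *s (nabla c u (\<lambda>y. ?E v y *v s y) x - nabla c v (\<lambda>y. ?E u y *v s y) x +
          (\<Psi> x u *v nabla c v s x - \<Psi> x v *v nabla c u s x))"
      by (simp add: vector_scalar_commute nabla_smult [OF V(1) f s V(2)]
          nabla_smult [OF V(1) f sm [OF s] V(2)] E_x
          matrix_vector_right_distrib vector_ssub_ldistrib vector_add_ldistrib)
  qed
  from The_matrix_on_sections [OF this W]
  show ?thesis unfolding cov_deriv_End_def L .
qed

end

section \<open>Linear algebra\<close>

lemma csmult_vector [simp]: "csmult a M *v w = a *s (M *v w)"
  by (simp add: csmult_def matrix_vector_mult_def vec_eq_iff sum_distrib_left mult.assoc)

lemma scaleR_matrix_vector: "(r *\<^sub>R M) *v (w :: complex^'m) = complex_of_real r *s (M *v w)"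
  by (simp add: matrix_vector_mult_def vec_eq_iff scaleR_sum_right flip: scaleR_conv_of_real)

lemma scaleR_matrix_mult_left: "(r *\<^sub>R M) ** (N :: complex^'m^'k) = r *\<^sub>R (M ** N)"
  by (simp add: matrix_matrix_mult_def vec_eq_iff scaleR_sum_right)

lemma scaleR_matrix_mult_right: "(M :: complex^'k^'m) ** (r *\<^sub>R N) = r *\<^sub>R (M ** N)"
  by (simp add: matrix_matrix_mult_def vec_eq_iff scaleR_sum_right)

section \<open>Algebra of types\<close>

lemma sec_part01_eq_0_iff: "sec_part01 \<beta> v = 0 \<longleftrightarrow> \<beta> (\<i> *s v) = \<i> *s \<beta> v"
proof -
  have "\<beta> v + \<i> *s \<beta> (\<i> *s v) = \<i> *s (\<beta> (\<i> *s v) - \<i> *s \<beta> v)"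
    by (simp add: vec_eq_iff algebra_simps)
  then show ?thesis
    unfolding sec_part01_def scaleR_eq_0_iff by (metis vector_mul_eq_0 right_minus_eq complex_i_not_zero
        zero_neq_one divide_eq_0_iff zero_neq_numeral)
qed

definition part02 :: "('x \<Rightarrow> complex^'n \<Rightarrow> complex^'n \<Rightarrow> complex^'r^'r) \<Rightarrow>
    'x \<Rightarrow> complex^'n \<Rightarrow> complex^'n \<Rightarrow> complex^'r^'r" where
  "part02 \<Omega> x u v = part01 (\<lambda>u'. part01 (\<lambda>v'. \<Omega> x u' v') v) u"

text \<open>In each argument \<open>part10\<close> and \<open>part01\<close> add up to the identity;
  the four combinations are grouped by type.\<close>

lemma type_decomposition: "\<Omega> x u v = part20 \<Omega> x u v + part11 \<Omega> x u v + part02 \<Omega> x u v"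
  by (simp add: part20_def part11_def part02_def part10_def part01_def csmult_def vec_eq_iff
      scaleR_conv_of_real [where 'a = complex] algebra_simps)

text \<open>This expansion and \<open>part02_vector\<close> differ only in the sign of
  \<open>i\<close>, which is how conjugation interchanges the two types.\<close>

lemma part20_vector: "part20 \<Omega> x u v *v a = (1/4) *s (\<Omega> x u v *v a - \<i> *s (\<Omega> x u (\<i> *s v) *v a)
    - \<i> *s (\<Omega> x (\<i> *s u) v *v a) - \<Omega> x (\<i> *s u) (\<i> *s v) *v a)"
  by (simp add: part20_def part10_def scaleR_matrix_vector matrix_vector_mult_diff_rdistrib
      vec_eq_iff algebra_simps)

lemma part02_vector: "part02 \<Omega> x u v *v a = (1/4) *s (\<Omega> x u v *v a + \<i> *s (\<Omega> x u (\<i> *s v) *v a)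
    + \<i> *s (\<Omega> x (\<i> *s u) v *v a) - \<Omega> x (\<i> *s u) (\<i> *s v) *v a)"
  by (simp add: part02_def part01_def scaleR_matrix_vector matrix_vector_mult_add_rdistrib
      vec_eq_iff algebra_simps)

lemma part20_complex_bilinear:
  assumes "\<And>u v. \<Omega> x u (\<i> *s v) = csmult \<i> (\<Omega> x u v)" "\<And>u v. \<Omega> x (\<i> *s u) v = csmult \<i> (\<Omega> x u v)"
  shows "part20 \<Omega> x u v = \<Omega> x u v"
  by (simp add: part20_def part10_def assms csmult_def vec_eq_iff scaleR_conv_of_real [where 'a = complex])

lemma hol_fun_matrix_vector:
  fixes P :: "'x::topological_space \<Rightarrow> complex^'m^'k"
  assumes "\<And>i j. hol_fun A V (\<lambda>y. P y $ i $ j)"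
  shows "hol_fun A V (\<lambda>y. (P y *v w) $ i)"
  unfolding hol_fun_def hol_on_def
proof (intro ballI)
  fix c z assume c: "c \<in> A" and z: "z \<in> snd c ` (V \<inter> fst c)"
  have hol: "hol_on ((\<lambda>y. P y $ i $ j) \<circ> chart_inv c) (snd c ` (V \<inter> fst c))" for j
    using assms c unfolding hol_fun_def by blast
  let ?L = "\<lambda>v. \<Sum>j\<in>UNIV. frechet_derivative ((\<lambda>y. P y $ i $ j) \<circ> chart_inv c) (at z) v * w $ j"
  have "((\<lambda>y. (P y *v w) $ i) \<circ> chart_inv c has_derivative ?L) (at z)"
    unfolding matrix_vector_mult_def comp_def vec_lambda_beta
    using hol_on_has_derivative(1) [OF hol z] unfolding comp_def
    by (intro has_derivative_sum has_derivative_mult_left)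
  moreover have "?L (a *s v) = a * ?L v" for a v
    by (simp add: hol_on_has_derivative(2) [OF hol z] sum_distrib_left mult.assoc)
  ultimately show "\<exists>L. ((\<lambda>y. (P y *v w) $ i) \<circ> chart_inv c has_derivative L) (at z) \<and>
      (\<forall>a v. L (a *s v) = a * L v)" by blast
qed

section \<open>Hermitian inner products\<close>

locale hermitian_inner =
  fixes k :: "complex^'r \<Rightarrow> complex^'r \<Rightarrow> complex"
  assumes add_left: "k (a + b) w = k a w + k b w"
    and smult_left: "k (z *s a) w = z * k a w"
    and conj_sym: "k b a = cnj (k a b)"
    and pos: "a \<noteq> 0 \<Longrightarrow> Re (k a a) > 0"
begin

lemma add_right: "k w (a + b) = k w a + k w b"
  by (metis add_left complex_cnj_add conj_sym)

lemma smult_right: "k w (z *s a) = cnj z * k w a"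
  by (metis smult_left complex_cnj_mult conj_sym)

lemma zero_left: "k 0 w = 0"
  using smult_left [of 0 0 w] by simp

lemma zero_right: "k w 0 = 0"
  using smult_right [of w 0 0] by simp

lemma diff_left: "k (a - b) w = k a w - k b w"
  using add_left [of a "(-1) *s b" w] smult_left [of "-1" b w] by simp

lemma diff_right: "k w (a - b) = k w a - k w b"
  using add_right [of w a "(-1) *s b"] smult_right [of w "-1" b] by simp

lemma eq_0I: "(\<And>b. k a b = 0) \<Longrightarrow> a = 0"
  using pos [of a] by fastforce

lemma sum_right: "k w (\<Sum>i\<in>I. f i) = (\<Sum>i\<in>I. k w (f i))"
  by (induction I rule: infinite_finite_induct) (auto simp: zero_right add_right)

lemma sum_left: "k (\<Sum>i\<in>I. f i) w = (\<Sum>i\<in>I. k (f i) w)"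
  by (induction I rule: infinite_finite_induct) (auto simp: zero_left add_left)

lemma basis_expansion_vector: "(b :: complex^'r) = (\<Sum>i\<in>UNIV. b $ i *s axis i 1)"
  by (simp add: vec_eq_iff axis_def if_distrib cong: if_cong)

lemma adjoint_unique:
  assumes "\<And>a b. k (B *v a) b = k (B' *v a) b"
  shows "B = B'"
  unfolding matrix_eq
proof
  fix a
  have "B *v a - B' *v a = 0" by (rule eq_0I) (simp add: diff_left assms)
  then show "B *v a = B' *v a" by simp
qed

text \<open>The Gram matrix \<open>K\<close> sends \<open>a\<close> to the numbers
  \<open>k a (axis i 1)\<close>. Positivity makes it injective, hence invertible, and the adjoint is
  \<open>K' ** N\<close>, where \<open>N\<close> collects the numbers
  \<open>k a (M *v axis i 1)\<close>.\<close>

lemma adjoint_exists: "\<exists>B. \<forall>a b. k (B *v a) b = k a (M *v b)"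
proof -
  define K where "K = (\<chi> i j. k (axis j 1) (axis i 1))"
  define N where "N = (\<chi> i j. k (axis j 1) (M *v axis i 1))"
  have expand: "k a w = (\<Sum>j\<in>UNIV. k (axis j 1) w * a $ j)" for a w
    by (subst basis_expansion_vector [of a]) (simp add: sum_left smult_left mult.commute)
  have K: "(K *v a) $ i = k a (axis i 1)" and N: "(N *v a) $ i = k a (M *v axis i 1)" for a i
    by (simp_all add: K_def N_def matrix_vector_mult_def expand [of a])
  have K0: "a = 0" if "K *v a = 0" for a
  proof (rule eq_0I)
    fix b
    have "k a (axis i 1) = 0" for i using that K [of a i] by simp
    then show "k a b = 0"
      by (subst basis_expansion_vector [of b]) (simp add: sum_right smult_right)
  qed
  have "inj ((*v) K)"
  proof (rule injI)
    fix a b assume "K *v a = K *v b"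
    then have "K *v (a - b) = 0" by (simp add: matrix_vector_mult_diff_distrib)
    from K0 [OF this] show "a = b" by simp
  qed
  then obtain K' where "K ** K' = mat 1"
    using matrix_left_invertible_injective matrix_left_right_inverse by blast
  then have KK: "K *v (K' *v w) = w" for w by (simp add: matrix_vector_mul_assoc)
  have "k ((K' ** N) *v a) b = k a (M *v b)" for a b
  proof -
    have basis: "k ((K' ** N) *v a) (axis i 1) = k a (M *v axis i 1)" for i
      by (simp add: K [symmetric] N [symmetric] KK flip: matrix_vector_mul_assoc)
    have Mb: "M *v b = (\<Sum>i\<in>UNIV. b $ i *s (M *v axis i 1))"
      by (simp add: vec_eq_iff matrix_vector_mult_def axis_def if_distrib mult.commute cong: if_cong)
    have "k ((K' ** N) *v a) b = (\<Sum>i\<in>UNIV. cnj (b $ i) * k ((K' ** N) *v a) (axis i 1))"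
      by (subst basis_expansion_vector [of b]) (simp add: sum_right smult_right)
    then show ?thesis by (simp add: basis Mb sum_right smult_right)
  qed
  then show ?thesis by blast
qed

lemma The_adjoint: "k ((THE B. \<forall>a b. k (B *v a) b = k a (M *v b)) *v a) b = k a (M *v b)"
proof -
  have "\<exists>!B. \<forall>a b. k (B *v a) b = k a (M *v b)"
    using adjoint_exists by (rule ex_ex1I) (rule adjoint_unique, simp)
  from theI' [OF this] show ?thesis by blast
qed

end

section \<open>The Chern connection\<close>

locale chern_bundle = bundle_connection A T D
  for A :: "('x::t2_space, 'n::finite) chart set" and T :: "('x, 'r::finite) triv set"
    and D :: "('x \<Rightarrow> complex^'r) \<Rightarrow> 'x \<Rightarrow> complex^'n \<Rightarrow> complex^'r" +
  fixes h :: "'x \<Rightarrow> complex^'r \<Rightarrow> complex^'r \<Rightarrow> complex"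
  assumes metric: "hermitian_metric A T h"
    and chern: "chern_connection A T h D"
begin

sublocale fibre: hermitian_inner "h x" for x
proof -
  note m = metric [unfolded hermitian_metric_def]
  note m2 = m [THEN conjunct2] and m3 = m [THEN conjunct2, THEN conjunct2]
  show "hermitian_inner (h x)"
    by (rule hermitian_inner.intro)
       (rule m [THEN conjunct1, rule_format] m2 [THEN conjunct1, rule_format]
          m3 [THEN conjunct1, rule_format] m3 [THEN conjunct2, THEN conjunct1, rule_format], assumption?)+
qed

lemma smooth_metric:
  assumes "open W" "smooth_section A T W s" "smooth_section A T W s'"
  shows "smooth_fun A W (\<lambda>x. h x (s x) (s' x))"
  by (rule metric [unfolded hermitian_metric_def, THEN conjunct2, THEN conjunct2, THEN conjunct2,
        THEN conjunct2, rule_format, OF assms])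

lemma metric_compatible:
  assumes "open W" "smooth_section A T W s" "smooth_section A T W s'" "x \<in> W"
  shows "differential A (\<lambda>y. h y (s y) (s' y)) x v = h x (D s x v) (s' x) + h x (s x) (D s' x v)"
  by (rule chern [unfolded chern_connection_def, THEN conjunct2, THEN conjunct2, rule_format, OF assms])

text \<open>Holomorphic components are annihilated by \<open>dbar\<close>, which is the (0,1) part
  of \<open>D\<close>. The lemma serves twice: for frame sections and for a holomorphic
  \<open>End E\<close>-valued form applied to them.\<close>

lemma holomorphic_section:
  assumes W: "open W" "smooth_section A T W s" "y \<in> W" and t: "t \<in> T" "y \<in> fst t"
    and V: "y \<in> V" "\<And>i. hol_fun A V (\<lambda>y. (snd t y *v s y) $ i)"
  shows "D s y (\<i> *s v) = \<i> *s D s y v"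
proof -
  have "sec_part01 (D s y) v = dbar A t s y v"
    using chern [unfolded chern_connection_def, THEN conjunct2, THEN conjunct1, rule_format,
        OF W(1,2) t(1), of y v] W(3) t(2) by simp
  moreover have "sec_part01 (differential A (\<lambda>y. snd t y *v s y) y) v = 0"
    unfolding sec_part01_eq_0_iff by (rule differential_holomorphic [OF V(2,1)])
  then have "dbar A t s y v = 0" by (simp add: dbar_def)
  ultimately have "sec_part01 (D s y) v = 0" by simp
  then show ?thesis unfolding sec_part01_eq_0_iff .
qed

lemma nabla_constant_section:
  assumes t: "t \<in> T" "y \<in> fst t" and c: "c \<in> A" "y \<in> fst c"
  shows "nabla c (\<i> *s v) (constant_section t w) y = \<i> *s nabla c v (constant_section t w) y"
proof -
  \<comment> \<open>The components of the frame section come from the transition of \<open>t\<close>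
    to itself, so their holomorphy is an instance of the bundle axiom.\<close>
  have "hol_fun A (fst t) (\<lambda>y. (snd t y ** matrix_inv (snd t y)) $ i $ j)" for i j
    using holo_bundle [unfolded holomorphic_bundle_def, THEN conjunct2, THEN conjunct2, rule_format,
        OF t(1) t(1)] by simp
  from hol_fun_matrix_vector [OF this]
  have "hol_fun A (fst t) (\<lambda>y. (snd t y *v constant_section t w y) $ i)" for i
    by (simp add: constant_section_def matrix_vector_mul_assoc)
  from holomorphic_section [OF open_triv [OF t(1)] smooth_constant_section [OF t(1)] t(2) t t(2) this]
  show ?thesis by (simp add: nabla_def coord_field_has_derivative(2) [OF c])
qed

text \<open>The identity of \<open>nabla_constant_section\<close> holds on a neighbourhood of
  \<open>x\<close>, so another covariant derivative may be applied to it. No linearity in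
  \<open>u\<close> is claimed.\<close>

lemma nabla_nabla_constant_section:
  assumes t: "t \<in> T" "x \<in> fst t" and c: "c \<in> A" "x \<in> fst c"
  shows "nabla c u (nabla c (\<i> *s v) (constant_section t w)) x = \<i> *s nabla c u (nabla c v (constant_section t w)) x"
proof -
  let ?e = "constant_section t w" and ?V = "fst t \<inter> fst c"
  have V: "open ?V" "x \<in> ?V" using open_triv [OF t(1)] open_chart [OF c(1)] t c by auto
  have sm: "smooth_section A T ?V (nabla c v ?e)" for v
    by (rule smooth_nabla [OF open_triv [OF t(1)] smooth_constant_section [OF t(1)] c(1)])
  have "nabla c u (nabla c (\<i> *s v) ?e) x = nabla c u (\<lambda>y. \<i> *s nabla c v ?e y) x"
    by (rule nabla_cong [OF V(1) sm smooth_section_smult [OF V(1) smooth_fun_const sm] _ V(2)])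
       (use nabla_constant_section [OF t(1) _ c(1)] in auto)
  also have "\<dots> = \<i> *s nabla c u (nabla c v ?e) x" by (rule nabla_smult_const [OF V(1) sm V(2)])
  finally show ?thesis .
qed

section \<open>Types of the curvature and of the covariant derivative\<close>

lemma matrix_eq_0_on_constant_sections:
  assumes "t \<in> T" "x \<in> fst t" "\<And>w. M *v constant_section t w x = 0"
  shows "M = 0"
  unfolding matrix_eq
proof
  fix a
  have "a = constant_section t (snd t x *v a) x" by (simp add: constant_section_def triv_inverse [OF assms(1,2)])
  then show "M *v a = 0 *v a" using assms(3) by (metis matrix_vector_mult_0)
qed

text \<open>On a frame section \<open>F(u,v)\<close> is \<open>N u v - N v u\<close>. Each of the
  two terms is complex linear in one of its arguments, while \<open>part02\<close> projects onto
  antilinearity in both.\<close>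

lemma curvature_02: "part02 (curvature A T D) x u v = 0"
proof -
  obtain t where t: "t \<in> T" "x \<in> fst t" by (rule triv_around)
  define c where "c = chart_at A x"
  have cA: "c \<in> A" "x \<in> fst c" unfolding c_def by (rule chart_at_in, rule in_chart_at)
  show ?thesis
  proof (rule matrix_eq_0_on_constant_sections [OF t])
    fix w
    define N where "N u v = nabla c u (nabla c v (constant_section t w)) x" for u v
    have N: "N u (\<i> *s v) = \<i> *s N u v" for u v
      unfolding N_def by (rule nabla_nabla_constant_section [OF t cA])
    have F: "curvature A T D x u v *v constant_section t w x = N u v - N v u" for u v
      unfolding N_def
      by (rule curvature_eq [OF open_triv [OF t(1)] t(2) smooth_constant_section [OF t(1)] c_def])
    show "part02 (curvature A T D) x u v *v constant_section t w x = 0"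
      unfolding part02_vector F N by (simp add: vec_eq_iff algebra_simps)
  qed
qed

text \<open>Antisymmetrise the second derivatives of the function \<open>h(s, s')\<close>: the terms with one
  derivative on each section cancel.\<close>

lemma curvature_skew_adjoint:
  "h x (curvature A T D x u v *v a) b + h x a (curvature A T D x u v *v b) = 0"
proof -
  obtain W1 s where s: "open W1" "x \<in> W1" "smooth_section A T W1 s" "s x = a" by (rule section_through)
  obtain W2 s' where s': "open W2" "x \<in> W2" "smooth_section A T W2 s'" "s' x = b" by (rule section_through)
  define c where "c = chart_at A x"
  have cA: "c \<in> A" "x \<in> fst c" unfolding c_def by (rule chart_at_in, rule in_chart_at)
  let ?W = "W1 \<inter> W2" and ?V = "W1 \<inter> W2 \<inter> fst c" and ?\<phi> = "\<lambda>y. h y (s y) (s' y)"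
  have W: "open ?W" "x \<in> ?W" using s s' by auto
  have V: "open ?V" "x \<in> ?V" using W open_chart [OF cA(1)] cA(2) by auto
  have sW: "smooth_section A T ?W s" "smooth_section A T ?W s'"
    using s(3) s'(3) by (auto intro: smooth_section_subset)
  have sV: "smooth_section A T ?V s" "smooth_section A T ?V s'"
    using sW by (auto intro: smooth_section_subset)
  note nV = smooth_nabla [OF W(1) sW(1) cA(1)] smooth_nabla [OF W(1) sW(2) cA(1)]
  note \<phi> = smooth_metric [OF W(1) sW]
  have D_x: "D s x u = nabla c u s x" for s u unfolding c_def by (rule nabla_chart_at [symmetric])
  have second: "differential A (coord_deriv A c v ?\<phi>) x u =
      h x (nabla c u (nabla c v s) x) (s' x) + h x (nabla c v s x) (nabla c u s' x) +
      (h x (nabla c u s x) (nabla c v s' x) + h x (s x) (nabla c u (nabla c v s') x))" for u v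
  proof -
    let ?p = "\<lambda>y. h y (nabla c v s y) (s' y)" and ?q = "\<lambda>y. h y (s y) (nabla c v s' y)"
    have p: "smooth_fun A ?V ?p" and q: "smooth_fun A ?V ?q"
      by (rule smooth_metric [OF V(1) nV(1) sV(2)], rule smooth_metric [OF V(1) sV(1) nV(2)])
    have "differential A (coord_deriv A c v ?\<phi>) x u = differential A (\<lambda>y. ?p y + ?q y) x u"
      by (rule differential_cong [OF V(1) smooth_fun_add [OF V(1) p q] V(2), symmetric])
         (simp add: coord_deriv_def metric_compatible [OF W(1) sW] nabla_def)
    also have "\<dots> = differential A ?p x u + differential A ?q x u"
      by (rule differential_add [OF p q V(2)])
    finally show ?thesis
      by (simp add: metric_compatible [OF V(1) nV(1) sV(2) V(2)]
          metric_compatible [OF V(1) sV(1) nV(2) V(2)] D_x)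
  qed
  have F: "curvature A T D x u v *v a = nabla c u (nabla c v s) x - nabla c v (nabla c u s) x"
    "curvature A T D x u v *v b = nabla c u (nabla c v s') x - nabla c v (nabla c u s') x"
    using curvature_eq [OF s(1-3) c_def] curvature_eq [OF s'(1-3) c_def] s(4) s'(4) by auto
  show ?thesis
    using coord_deriv_symmetric [OF W(1) \<phi> W(2) c_def, of v u]
    unfolding second F by (simp add: fibre.diff_left fibre.diff_right s(4) s'(4) algebra_simps)
qed

text \<open>Moving \<open>F\<close> to the other side of \<open>h\<close> changes its sign, and
  \<open>i\<close> becomes \<open>-i\<close> in the conjugate linear slot. Thus the coefficients of
  \<open>part20_vector\<close> turn into those of \<open>part02_vector\<close>, and
  \<open>curvature_02\<close> applies.\<close>

lemma curvature_20: "part20 (curvature A T D) x u v = 0"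
proof -
  let ?F = "curvature A T D"
  have skew: "h x (?F x u v *v a) b = - h x a (?F x u v *v b)" for u v a b
    using curvature_skew_adjoint [of x u v a b] by (simp add: eq_neg_iff_add_eq_0)
  have "h x (part20 ?F x u v *v a) b = - h x a (part02 ?F x u v *v b)" for a b
    unfolding part20_vector part02_vector
    by (simp add: fibre.smult_left fibre.smult_right fibre.diff_left fibre.diff_right
        fibre.add_left fibre.add_right skew algebra_simps)
  then have "h x (part20 ?F x u v *v a) b = 0" for a b by (simp add: curvature_02 fibre.zero_right)
  then have "part20 ?F x u v *v a = 0" for a by (rule fibre.eq_0I)
  then show ?thesis by (simp add: matrix_eq)
qed

lemma curvature_11: "part11 (curvature A T D) x u v = curvature A T D x u v"
  using type_decomposition [of "curvature A T D" x u v] by (simp add: curvature_20 curvature_02)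

text \<open>It suffices to test complex linearity on frame sections. All four terms of
  \<open>cov_deriv_End_eq\<close> are then complex linear in \<open>v\<close>: two because
  \<open>\<Psi>\<close> has type (1,0), two because frame sections and their images under
  \<open>\<Psi>\<close> are holomorphic.\<close>

lemma cov_deriv_End_holomorphic:
  assumes \<Psi>: "form10 A T \<Psi>" "holomorphic_End_form1 A T \<Psi>"
  shows "part20 (cov_deriv_End A T D \<Psi>) x u v = cov_deriv_End A T D \<Psi> x u v"
proof -
  let ?\<Omega> = "cov_deriv_End A T D \<Psi> x"
  have sm: "smooth_End_form1 A T \<Psi>" and J: "\<And>y v. \<Psi> y (\<i> *s v) = csmult \<i> (\<Psi> y v)"
    using \<Psi>(1) unfolding form10_def by auto
  obtain t where t: "t \<in> T" "x \<in> fst t" by (rule triv_around)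
  define c where "c = chart_at A x"
  have cA: "c \<in> A" "x \<in> fst c" unfolding c_def by (rule chart_at_in, rule in_chart_at)
  let ?V = "fst c \<inter> fst t"
  have V: "open ?V" "x \<in> ?V" using open_triv [OF t(1)] open_chart [OF cA(1)] t cA by auto
  let ?E = "End_component \<Psi> c"
  \<comment> \<open>Antisymmetry transfers complex linearity from the second argument to the
    first.\<close>
  have anti: "?\<Omega> v u = - ?\<Omega> u v" for u v
  proof (rule matrix_eq_on_sections [of x])
    fix W s assume W: "open W" "x \<in> W" "smooth_section A T W s"
    show "?\<Omega> v u *v s x = (- ?\<Omega> u v) *v s x"
      using cov_deriv_End_eq [OF sm W c_def, of u v] cov_deriv_End_eq [OF sm W c_def, of v u]
        matrix_vector_mult_diff_rdistrib [of 0 "?\<Omega> u v" "s x"] by simp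
  qed
  have lin: "?\<Omega> u (\<i> *s v) = csmult \<i> (?\<Omega> u v)" for u v
  proof -
    have "?\<Omega> u (\<i> *s v) - csmult \<i> (?\<Omega> u v) = 0"
    proof (rule matrix_eq_0_on_constant_sections [OF t])
      fix w
      let ?e = "constant_section t w"
      have e: "smooth_section A T ?V ?e"
        by (rule smooth_section_subset [OF smooth_constant_section [OF t(1)]]) simp
      have Ee: "smooth_section A T ?V (\<lambda>y. ?E v y *v ?e y)" for v
        by (rule smooth_End_component [OF sm V(1) e cA(1)]) simp
      have E_J: "?E (\<i> *s v) y *v ?e y = \<i> *s (?E v y *v ?e y)" if "y \<in> ?V" for y v
        using that by (simp add: End_component_def coord_field_has_derivative(2) [OF cA(1)] J)
      have 1: "nabla c u (\<lambda>y. ?E (\<i> *s v) y *v ?e y) x = \<i> *s nabla c u (\<lambda>y. ?E v y *v ?e y) x" for u v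
      proof -
        have "nabla c u (\<lambda>y. ?E (\<i> *s v) y *v ?e y) x = nabla c u (\<lambda>y. \<i> *s (?E v y *v ?e y)) x"
          by (rule nabla_cong [OF V(1) Ee smooth_section_smult [OF V(1) smooth_fun_const Ee] E_J V(2)])
        also have "\<dots> = \<i> *s nabla c u (\<lambda>y. ?E v y *v ?e y) x"
          by (rule nabla_smult_const [OF V(1) Ee V(2)])
        finally show ?thesis .
      qed
      have 2: "nabla c (\<i> *s v) (\<lambda>y. ?E u y *v ?e y) x = \<i> *s nabla c v (\<lambda>y. ?E u y *v ?e y) x" for u v
      proof -
        \<comment> \<open>The components of the image of the frame section are the matrix of
          \<open>\<Psi>\<close> in the frame applied to the constant vector
          \<open>w\<close>.\<close>
        have "hol_fun A ?V (\<lambda>y. (snd t y ** ?E u y ** matrix_inv (snd t y)) $ i $ j)" for i j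
          using \<Psi>(2) t(1) cA(1) unfolding holomorphic_End_form1_def End_component_def by blast
        from hol_fun_matrix_vector [OF this]
        have "hol_fun A ?V (\<lambda>y. (snd t y *v (?E u y *v ?e y)) $ i)" for i
          by (simp add: constant_section_def matrix_vector_mul_assoc matrix_mul_assoc)
        from holomorphic_section [OF V(1) Ee V(2) t V(2) this, of "coord_field A c v x"]
        show ?thesis by (simp add: nabla_def coord_field_has_derivative(2) [OF cA])
      qed
      show "(?\<Omega> u (\<i> *s v) - csmult \<i> (?\<Omega> u v)) *v ?e x = 0"
        unfolding matrix_vector_mult_diff_rdistrib csmult_vector
          cov_deriv_End_eq [OF sm V e c_def] 1 2 J nabla_constant_section [OF t cA]
        by (simp add: vec_eq_iff vector_scalar_commute algebra_simps)
    qed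
    then show ?thesis by simp
  qed
  have "?\<Omega> (\<i> *s u) v = csmult \<i> (?\<Omega> u v)" for u v
    unfolding anti [of "\<i> *s u"] lin anti [of u v] by (simp add: csmult_def vec_eq_iff)
  with lin show ?thesis by (rule part20_complex_bilinear)
qed

section \<open>Rescaling the Higgs field\<close>

lemma cov_deriv_End_scaleR:
  assumes sm: "smooth_End_form1 A T \<Psi>" "smooth_End_form1 A T (\<lambda>x v. r *\<^sub>R \<Psi> x v)"
  shows "cov_deriv_End A T D (\<lambda>x v. r *\<^sub>R \<Psi> x v) x u v = r *\<^sub>R cov_deriv_End A T D \<Psi> x u v"
proof (rule matrix_eq_on_sections [of x])
  fix W s assume W: "open W" "x \<in> W" "smooth_section A T W s"
  define c where "c = chart_at A x"
  have cA: "c \<in> A" "x \<in> fst c" unfolding c_def by (rule chart_at_in, rule in_chart_at)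
  let ?V = "W \<inter> fst c"
  have V: "open ?V" "x \<in> ?V" using W open_chart [OF cA(1)] cA(2) by auto
  have s: "smooth_section A T ?V s" by (rule smooth_section_subset [OF W(3)]) auto
  have "smooth_section A T ?V (\<lambda>y. End_component \<Psi> c v y *v s y)" for v
    by (rule smooth_End_component [OF sm(1) V(1) s cA(1)]) simp
  note * = nabla_smult_const [OF V(1) this V(2)]
  show "cov_deriv_End A T D (\<lambda>x v. r *\<^sub>R \<Psi> x v) x u v *v s x = (r *\<^sub>R cov_deriv_End A T D \<Psi> x u v) *v s x"
    unfolding scaleR_matrix_vector cov_deriv_End_eq [OF sm(1) W c_def] cov_deriv_End_eq [OF sm(2) W c_def]
      End_component_def [of "\<lambda>x v. r *\<^sub>R \<Psi> x v"] End_component_def [of \<Psi>, symmetric] *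
    by (simp add: vec_eq_iff algebra_simps)
qed

text \<open>A real factor is its own conjugate, so the commutator of a form with its hermitian
  conjugate scales by \<open>r * r\<close>.\<close>

lemma herm_conj_scaleR: "herm_conj h (\<lambda>x v. r *\<^sub>R \<Psi> x v) x v = r *\<^sub>R herm_conj h \<Psi> x v"
proof (rule fibre.adjoint_unique)
  have adj: "h x (herm_conj h \<Psi> x v *v a) b = h x a (\<Psi> x v *v b)" for \<Psi> a b
    unfolding herm_conj_def by (rule fibre.The_adjoint)
  fix a b
  show "h x (herm_conj h (\<lambda>x v. r *\<^sub>R \<Psi> x v) x v *v a) b = h x ((r *\<^sub>R herm_conj h \<Psi> x v) *v a) b"
    by (simp add: adj scaleR_matrix_vector fibre.smult_left fibre.smult_right)
qed

end

lemma commutator_scaleR: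
  "commutator (\<lambda>x v. r *\<^sub>R \<Phi> x v) (\<lambda>x v. r *\<^sub>R \<Psi> x v) x u v = (r * r) *\<^sub>R commutator \<Phi> \<Psi> x u v"
  by (simp add: commutator_def wedge_def scaleR_matrix_mult_left scaleR_matrix_mult_right algebra_simps)

lemma (in complex_manifold) higgs_field_scaleR:
  assumes "holomorphic_bundle A T" "higgs_field A T \<Phi>"
  shows "higgs_field A T (\<lambda>x v. r *\<^sub>R \<Phi> x v)"
proof -
  have \<Phi>: "\<And>x. linear (\<Phi> x)"
    "\<And>c t v. c \<in> A \<Longrightarrow> t \<in> T \<Longrightarrow> smooth_fun A (fst c \<inter> fst t)
        (\<lambda>y. snd t y ** \<Phi> y (coord_field A c v y) ** matrix_inv (snd t y))"
    "\<And>x v. \<Phi> x (\<i> *s v) = csmult \<i> (\<Phi> x v)"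
    "\<And>c t v i j. c \<in> A \<Longrightarrow> t \<in> T \<Longrightarrow> hol_fun A (fst c \<inter> fst t)
        (\<lambda>y. (snd t y ** \<Phi> y (coord_field A c v y) ** matrix_inv (snd t y)) $ i $ j)"
    "\<And>x u v. wedge \<Phi> \<Phi> x u v = 0"
    using assms(2) unfolding higgs_field_def form10_def smooth_End_form1_def holomorphic_End_form1_def
    by simp_all
  have op: "open (fst c \<inter> fst t)" if "c \<in> A" "t \<in> T" for c t
    using that open_chart assms(1) unfolding holomorphic_bundle_def by blast
  have "linear (\<lambda>v. r *\<^sub>R \<Phi> x v)" for x
    using \<Phi>(1) by (rule linear_compose_scale_right)
  moreover have "smooth_fun A (fst c \<inter> fst t)
      (\<lambda>y. snd t y ** (r *\<^sub>R \<Phi> y (coord_field A c v y)) ** matrix_inv (snd t y))"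
    if "c \<in> A" "t \<in> T" for c t v
    using smooth_fun_bounded_linear [OF op [OF that] bounded_linear_scaleR_right \<Phi>(2) [OF that]]
    by (simp add: scaleR_matrix_mult_left scaleR_matrix_mult_right)
  \<comment> \<open>Applying the matrix to \<open>r\<close> times the \<open>j\<close>-th basis
    vector yields the scaled \<open>j\<close>-th column, so holomorphy of matrix-vector products is
    enough.\<close>
  moreover have "hol_fun A (fst c \<inter> fst t)
      (\<lambda>y. (snd t y ** (r *\<^sub>R \<Phi> y (coord_field A c v y)) ** matrix_inv (snd t y)) $ i $ j)"
    if "c \<in> A" "t \<in> T" for c t v i j
    using hol_fun_matrix_vector [OF \<Phi>(4) [OF that], of v "complex_of_real r *s axis j 1" i]
    by (simp add: scaleR_matrix_mult_left scaleR_matrix_mult_right matrix_vector_mult_def axis_def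
        scaleR_conv_of_real [where 'a = complex] if_distrib mult.commute cong: if_cong)
  moreover have "wedge (\<lambda>x v. r *\<^sub>R \<Phi> x v) (\<lambda>x v. r *\<^sub>R \<Phi> x v) x u v = (r * r) *\<^sub>R wedge \<Phi> \<Phi> x u v" for x u v
    by (simp add: wedge_def scaleR_matrix_mult_left scaleR_matrix_mult_right algebra_simps)
  moreover have "r *\<^sub>R \<Phi> x (\<i> *s v) = csmult \<i> (r *\<^sub>R \<Phi> x v)" for x v
    by (simp add: \<Phi>(3) csmult_def vec_eq_iff)
  ultimately show ?thesis
    unfolding higgs_field_def form10_def smooth_End_form1_def holomorphic_End_form1_def
    by (simp add: \<Phi>(5))
qed

theorem mainTheorem1:
  fixes A :: "('x::t2_space, 'n::finite) chart set"
    and \<omega> :: "'x \<Rightarrow> complex^'n \<Rightarrow> complex^'n \<Rightarrow> real"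
    and T :: "('x, 'r::finite) triv set"
    and \<Phi> \<Phi>' :: "'x \<Rightarrow> complex^'n \<Rightarrow> complex^'r^'r"
    and h :: "'x \<Rightarrow> complex^'r \<Rightarrow> complex^'r \<Rightarrow> complex"
    and D :: "('x \<Rightarrow> complex^'r) \<Rightarrow> 'x \<Rightarrow> complex^'n \<Rightarrow> complex^'r"
  assumes "compact (UNIV :: 'x set)"
    and "complex_atlas A"
    and "kaehler_form A \<omega>"
    and "holomorphic_bundle A T"
    and "higgs_field A T \<Phi>"
    and "hermitian_metric A T h"
    and "chern_connection A T h D"
    and "\<Phi> = (\<lambda>x v. 2 *\<^sub>R \<Phi>' x v)"
  shows "(\<forall>x u v. commutator \<Phi> \<Phi> x u v = 0)
    \<and> (\<forall>x u v. part20 (curvature A T D) x u v = 0)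
    \<and> higgs_field A T \<Phi>'
    \<and> (hitchin_2k A T h D \<Phi> \<longleftrightarrow>
         (\<forall>x u v. cov_deriv_End' A T D \<Phi>' x u v = 0) \<and>
         (\<forall>x u v. curvature A T D x u v + commutator \<Phi>' (herm_conj h \<Phi>') x u v = 0))"
proof -
  interpret chern_bundle A T D h
  proof unfold_locales
    show "connection A T D" using assms(7) unfolding chern_connection_def by blast
  qed (rule assms)+
  have comm: "commutator \<Phi> \<Phi> x u v = 0" for x u v
    using assms(5) unfolding higgs_field_def commutator_def by simp
  have half: "\<Phi>' = (\<lambda>x v. (1/2) *\<^sub>R \<Phi> x v)" by (simp add: assms(8))
  have higgs': "higgs_field A T \<Phi>'"
    unfolding half by (rule higgs_field_scaleR [OF assms(4,5)])
  \<comment> \<open>The covariant derivative acquires the factor 2, which does not affect its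
    vanishing. The commutator acquires 2 from each entry, and this 4 cancels the coefficient
    1/4.\<close>
  have "cov_deriv_End A T D \<Phi> x u v = 2 *\<^sub>R cov_deriv_End A T D \<Phi>' x u v" for x u v
    using assms(5) higgs' unfolding assms(8) higgs_field_def form10_def
    by (intro cov_deriv_End_scaleR) auto
  moreover have "cov_deriv_End' A T D \<Phi>' x u v = cov_deriv_End A T D \<Phi>' x u v" for x u v
    using higgs' unfolding cov_deriv_End'_def higgs_field_def
    by (intro cov_deriv_End_holomorphic) auto
  moreover have "herm_conj h \<Phi> = (\<lambda>x v. 2 *\<^sub>R herm_conj h \<Phi>' x v)"
    by (simp add: assms(8) herm_conj_scaleR fun_eq_iff)
  then have "commutator \<Phi> (herm_conj h \<Phi>) x u v = 4 *\<^sub>R commutator \<Phi>' (herm_conj h \<Phi>') x u v" for x u v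
    by (simp add: assms(8) commutator_scaleR)
  ultimately have "hitchin_2k A T h D \<Phi> \<longleftrightarrow>
      (\<forall>x u v. cov_deriv_End' A T D \<Phi>' x u v = 0) \<and>
      (\<forall>x u v. curvature A T D x u v + commutator \<Phi>' (herm_conj h \<Phi>') x u v = 0)"
    unfolding hitchin_2k_def by (simp add: comm curvature_20 curvature_11)
  then show ?thesis using comm curvature_20 higgs' by blast
qed

end
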